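(* Let $r\in\mathbb{N}_0$ and $m\in\mathbb{N}$ with $m\ge r+2$, and let $x_0\le x_1\le\dots\le x_{m-1}$ be real numbers; put $I:=[x_0,x_{m-1}]$, $|I|:=x_{m-1}-x_0$. Suppose that for some $0<\lambda\le1$, \[ x_{j+r+1}-x_j\ge\lambda|I|\quad\text{for all }0\le j\le m-r-2. \] If $f\in C^{(r)}(I)$, then for each $x\in I$, \[ \big|f(x)-L_{m-1}(x;f;x_0,\dots,x_{m-1})\big|\le C(m,\lambda)\,\mathcal{D}_r(x,X)\int_{|x-x_{\sigma_r}|}^{2|I|}\frac{\omega_{m-r}(f^{(r)},t,I)}{t^2}\,dt, \] where $C(m,\lambda)$ depends only on $m$ and $\lambda$.
   Context: $X=\{x_j\}_{j=0}^{m-1}$. For $x\in I$, $\sigma=(\sigma_0,\dots,\sigma_{m-1})$ is a permutation of $(0,\dots,m-1)$ with $|x-x_{\sigma_{\nu-1}}|\le|x-x_{\sigma_\nu}|$ for $1\le\nu\le m-1$ (any such choice), and $\mathcal{D}_r(x,X):=\prod_{\nu=0}^r|x-x_{\sigma_\nu}|$. $L_{m-1}(\cdot;f;x_0,\dots,x_{m-1})$ is the Hermite interpolation polynomial of degree $\le m-1$: with $l_j$ the number of indices $i\le j$ with $x_i=x_j$, $L_{m-1}^{(l_j-1)}(x_j)=f^{(l_j-1)}(x_j)$ for all $j$. Modulus of smoothness: $\omega_k(g,t;[a,b]):=\sup_{0<u\le t}\sup_x|\Delta^k_u(g,x;[a,b])|$, with $\Delta^k_u(g,x;[a,b]):=\sum_{i=0}^k(-1)^i\binom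 ki g(x+(k/2-i)u)$ if $x\pm(k/2)u\in[a,b]$ and $0$ otherwise. *)

theory Defs
  imports "HOL-Analysis.Analysis" "HOL-Computational_Algebra.Polynomial"
begin

definition node_mult :: "(nat \<Rightarrow> real) \<Rightarrow> nat \<Rightarrow> nat" where
  "node_mult xs j = card {i. i \<le> j \<and> xs i = xs j}"

text \<open>Hermite interpolation polynomial L_{m-1}(.; f; x_0,...,x_{m-1}) of degree \<le> m-1,
  where df k denotes the k-th derivative of f.\<close>
definition hermite_interp :: "(nat \<Rightarrow> real \<Rightarrow> real) \<Rightarrow> (nat \<Rightarrow> real) \<Rightarrow> nat \<Rightarrow> real poly" where
  "hermite_interp df xs m = (THE p. degree p \<le> m - 1 \<and>
     (\<forall>j<m. poly ((pderiv ^^ (node_mult xs j - 1)) p) (xs j) = df (node_mult xs j - 1) (xs j)))"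

definition sym_diff :: "nat \<Rightarrow> real \<Rightarrow> (real \<Rightarrow> real) \<Rightarrow> real \<Rightarrow> real \<Rightarrow> real \<Rightarrow> real" where
  "sym_diff k u g x a b =
     (if a \<le> x - (real k / 2) * u \<and> x + (real k / 2) * u \<le> b
      then (\<Sum>i=0..k. (-1) ^ i * real (k choose i) * g (x + (real k / 2 - real i) * u))
      else 0)"

definition mod_smooth :: "nat \<Rightarrow> (real \<Rightarrow> real) \<Rightarrow> real \<Rightarrow> real \<Rightarrow> real \<Rightarrow> real" where
  "mod_smooth k g t a b = (SUP u\<in>{0<..t}. SUP x. \<bar>sym_diff k u g x a b\<bar>)"

text \<open>D_r(x,X) for a given nearest-node ordering sigma.\<close>
definition dist_prod :: "nat \<Rightarrow> real \<Rightarrow> (nat \<Rightarrow> real) \<Rightarrow> (nat \<Rightarrow> nat) \<Rightarrow> real" where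
  "dist_prod r x xs \<sigma> = (\<Prod>\<nu>=0..r. \<bar>x - xs (\<sigma> \<nu>)\<bar>)"

end

theory Submission
  imports Defs
begin

text \<open>Let k = m - r, g the r-th derivative of f, and w its k-th modulus of smoothness on an interval
  of length h. Interpolation reproduces polynomials of degree below m, so by Whitney's inequality
  one may assume that g is bounded by a multiple of w h. The Newton form of the interpolant, with
  the nodes ordered by distance from x, gives the factor D_r(x, X) times a sum of divided
  differences. Those of nodes only are estimated by the separation of any r + 2 nodes; the one
  containing x is a difference quotient of values of g over the distance d from x to the (r+1)-st
  nearest node, hence at most 2/d times the modulus of continuity of g at d, and Marchaud's
  inequality bounds the latter by the integral.\<close>

section \<open>Hermite interpolation and divided differences\<close>

text \<open>Nodes are kept as multisets: divided differences are then symmetric by construction and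
  make sense for repeated nodes, and the recursion, written without division, needs no case split.
  The mean value form is available only for r + 1 nodes, because f has only r derivatives. For more
  nodes the recursion divides by a node distance; dropping either of the two extreme indices keeps
  that distance at least lambda |I|. With x as an additional point this fails, since x may lie close
  to the nodes: only d can be divided by, and the numerator has to be small with d. The modulus of
  continuity at d supplies this, provided that the mean value points stay within d of x. Marchaud's
  inequality leaves a second term, the supremum of g times d / |I|. Whitney makes that supremum a
  multiple of w h, and the integral controls w h / h through its part from h to 2h. This is the use
  of the upper limit 2|I|, as d may be close to |I|. Whitney's inequality is in turn obtained from a
  form of Marchaud's without the integral.\<close>

definition node_poly :: "real multiset \<Rightarrow> real poly" where
  "node_poly M = (\<Prod>z\<in>#M. [:- z, 1:])"

text \<open>The degree bound is put on the coefficients because for empty \<open>M\<close> it has to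
  force \<open>p = 0\<close>, which a bound on the natural number \<open>degree p\<close> alone
  cannot say.\<close>

definition is_hermite :: "(nat \<Rightarrow> real \<Rightarrow> real) \<Rightarrow> real multiset \<Rightarrow> real poly \<Rightarrow> bool" where
  "is_hermite df M p \<longleftrightarrow> (\<forall>i\<ge>size M. coeff p i = 0) \<and>
     (\<forall>z i. i < count M z \<longrightarrow> poly ((pderiv ^^ i) p) z = df i z)"

definition hermite_poly :: "(nat \<Rightarrow> real \<Rightarrow> real) \<Rightarrow> real multiset \<Rightarrow> real poly" where
  "hermite_poly df M = (THE p. is_hermite df M p)"

text \<open>As the top coefficient of an interpolant over a multiset, the divided difference does
  not depend on an order of the nodes and covers repeated ones.\<close>

definition divdiff :: "(nat \<Rightarrow> real \<Rightarrow> real) \<Rightarrow> real multiset \<Rightarrow> real" where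
  "divdiff df M = coeff (hermite_poly df M) (size M - 1)"

lemma node_poly_empty [simp]: "node_poly {#} = 1"
  by (simp add: node_poly_def)

lemma node_poly_add [simp]: "node_poly (add_mset b M) = [:- b, 1:] * node_poly M"
  by (simp add: node_poly_def)

lemma node_poly_degree: "degree (node_poly M) = size M" "coeff (node_poly M) (size M) = 1"
proof (induction M)
  case (add b M)
  have nz: "node_poly M \<noteq> 0" using add by auto
  case 1
  show ?case using nz add by (simp add: degree_mult_eq del: mult_pCons_left)
  case 2
  have "lead_coeff ([:- b, 1:] * node_poly M) = 1"
    unfolding lead_coeff_mult using add by simp
  then show ?case using \<open>degree (node_poly (add_mset b M)) = size (add_mset b M)\<close> by simp
qed simp_all

text \<open>Leibniz' rule with a linear factor, whose second derivative vanishes. The truncation of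
  \<open>i - 1\<close> at \<open>i = 0\<close> is harmless, because that summand carries the factor
  \<open>i\<close>.\<close>

lemma poly_higher_pderiv_linear_factor:
  fixes p :: "real poly"
  shows "poly ((pderiv ^^ i) ([:- b, 1:] * p)) z =
    (z - b) * poly ((pderiv ^^ i) p) z + real i * poly ((pderiv ^^ (i - 1)) p) z"
proof -
  have "(pderiv ^^ i) ([:- b, 1:] * p) =
     [:- b, 1:] * (pderiv ^^ i) p + smult (of_nat i) ((pderiv ^^ (i - 1)) p)"
  proof (induction i)
    case (Suc i)
    have "(pderiv ^^ Suc i) ([:- b, 1:] * p) =
       [:- b, 1:] * pderiv ((pderiv ^^ i) p) + (pderiv ^^ i) p
        + smult (of_nat i) (pderiv ((pderiv ^^ (i - 1)) p))"
      using Suc by (simp add: pderiv_add pderiv_mult pderiv_smult pderiv_pCons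
          pderiv_diff del: mult_pCons_left)
    also have "smult (of_nat i) (pderiv ((pderiv ^^ (i - 1)) p)) = smult (of_nat i) ((pderiv ^^ i) p)"
      by (cases i) simp_all
    finally show ?case
      by (simp add: smult_add_left algebra_simps)
  qed simp
  from arg_cong[OF this, of "\<lambda>q. poly q z"] show ?thesis
    by (simp only: poly_add poly_smult poly_mult) simp
qed

lemma node_poly_vanishes: "i < count M z \<Longrightarrow> poly ((pderiv ^^ i) (node_poly M)) z = 0"
proof (induction M arbitrary: i)
  case (add b M)
  show ?case
  proof (cases "z = b")
    case True
    then show ?thesis
      using add by (cases i) (simp_all add: poly_higher_pderiv_linear_factor del: mult_pCons_left funpow.simps)
  next
    case False
    then show ?thesis
      using add by (simp add: poly_higher_pderiv_linear_factor del: mult_pCons_left)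
  qed
qed simp

text \<open>This makes Newton's construction solvable: a multiple of \<open>node_poly M\<close>
  keeps all conditions of \<open>M\<close> and moves the next derivative at \<open>z\<close> to any
  prescribed value.\<close>

lemma node_poly_nonvanishing: "poly ((pderiv ^^ count M z) (node_poly M)) z \<noteq> 0"
proof (induction M)
  case (add b M)
  show ?case
  proof (cases "z = b")
    case True
    then show ?thesis
      using add by (simp add: poly_higher_pderiv_linear_factor del: mult_pCons_left funpow.simps)
  next
    case False
    have zero: "real (count M z) * poly ((pderiv ^^ (count M z - 1)) (node_poly M)) z = 0"
      by (cases "count M z") (simp_all add: node_poly_vanishes del: funpow.simps)
    have "poly ((pderiv ^^ count M z) (node_poly (add_mset b M))) z =
        (z - b) * poly ((pderiv ^^ count M z) (node_poly M)) z"
      by (simp only: node_poly_add poly_higher_pderiv_linear_factor zero add_0_right)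
    then show ?thesis using False add by simp
  qed
qed simp

lemma higher_pderiv_diff: "(pderiv ^^ n) (p - q) = (pderiv ^^ n) p - (pderiv ^^ n) (q :: real poly)"
  by (induction n) (simp_all add: pderiv_diff)

lemma is_hermite_exists: "\<exists>p. is_hermite df M p"
proof (induction M)
  case empty
  have "is_hermite df {#} 0" by (simp add: is_hermite_def)
  then show ?case ..
next
  case (add b M)
  then obtain p where p: "is_hermite df M p" by blast
  define n where "n = count M b"
  define c where "c = (df n b - poly ((pderiv ^^ n) p) b) / poly ((pderiv ^^ n) (node_poly M)) b"
  have "is_hermite df (add_mset b M) (p + smult c (node_poly M))"
    unfolding is_hermite_def
  proof (intro conjI allI impI)
    fix i assume "size (add_mset b M) \<le> i"
    then show "coeff (p + smult c (node_poly M)) i = 0"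
      using p by (simp add: is_hermite_def coeff_eq_0 node_poly_degree)
  next
    fix z i assume i: "i < count (add_mset b M) z"
    show "poly ((pderiv ^^ i) (p + smult c (node_poly M))) z = df i z"
    proof (cases "i < count M z")
      case True
      then show ?thesis
        using p by (simp add: is_hermite_def higher_pderiv_add higher_pderiv_smult node_poly_vanishes)
    next
      case False
      then have "z = b" "i = n" using i by (auto simp: n_def split: if_splits)
      moreover have "poly ((pderiv ^^ n) (node_poly M)) b \<noteq> 0"
        unfolding n_def by (rule node_poly_nonvanishing)
      ultimately show ?thesis
        by (simp add: higher_pderiv_add higher_pderiv_smult c_def)
    qed
  qed
  then show ?case ..
qed

text \<open>Dividing \<open>q\<close> by the linear factor of one node leaves a quotient with zero
  conditions for the remaining nodes. At that node one order is lost; elsewhere the derivatives of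
  the quotient vanish one after the other, since \<open>z - a\<close> is not zero.\<close>

lemma is_hermite_zero: "is_hermite (\<lambda>_ _. 0) M q \<Longrightarrow> q = 0"
proof (induction M arbitrary: q)
  case empty
  then show ?case by (simp add: is_hermite_def poly_eq_iff)
next
  case (add a M)
  have van: "i < count (add_mset a M) z \<Longrightarrow> poly ((pderiv ^^ i) q) z = 0" for i z
    using add.prems by (simp add: is_hermite_def)
  from van[of 0 a] have "poly q a = 0" by simp
  then obtain s where s: "q = [:- a, 1:] * s" by (metis dvdE poly_eq_0_iff_dvd)
  have "is_hermite (\<lambda>_ _. 0) M s"
    unfolding is_hermite_def
  proof (intro conjI allI impI)
    fix i assume i: "size M \<le> i"
    show "coeff s i = 0"
    proof (cases "s = 0")
      case False
      then have "degree q = Suc (degree s)" and "q \<noteq> 0"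
        unfolding s by (simp_all add: degree_mult_eq del: mult_pCons_left)
      then have "degree s < size M"
        using add.prems unfolding is_hermite_def
        by (metis Suc_le_mono leading_coeff_0_iff not_le size_add_mset)
      then show ?thesis using i by (simp add: coeff_eq_0)
    qed simp
  next
    fix z i assume i: "i < count M z"
    show "poly ((pderiv ^^ i) s) z = 0"
    proof (cases "z = a")
      case True
      then show ?thesis
        using van[of "Suc i" a] i
        by (simp add: s poly_higher_pderiv_linear_factor del: mult_pCons_left funpow.simps)
    next
      case False
      from i show ?thesis
      proof (induction i)
        case 0
        then show ?case using van[of 0 z] False by (simp add: s)
      next
        case (Suc i)
        then show ?case
          using van[of "Suc i" z] False
          by (simp add: s poly_higher_pderiv_linear_factor del: mult_pCons_left funpow.simps)
      qed
    qed
  qed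
  then have "s = 0" by (rule add.IH)
  then show ?case by (simp add: s)
qed

lemma is_hermite_diff:
  "is_hermite df M p \<Longrightarrow> is_hermite dg M q \<Longrightarrow> is_hermite (\<lambda>i z. df i z - dg i z) M (p - q)"
  by (simp add: is_hermite_def higher_pderiv_diff)

lemma is_hermite_unique: "is_hermite df M p \<Longrightarrow> is_hermite df M q \<Longrightarrow> p = q"
  using is_hermite_zero[of M "p - q"] is_hermite_diff[of df M p df q] by simp

lemma is_hermite_hermite_poly: "is_hermite df M (hermite_poly df M)"
  unfolding hermite_poly_def by (metis is_hermite_exists is_hermite_unique theI')

lemma hermite_poly_eqI: "is_hermite df M p \<Longrightarrow> hermite_poly df M = p"
  using is_hermite_hermite_poly is_hermite_unique by blast

text \<open>Subtracting the right multiple of \<open>node_poly M\<close> removes the top coefficient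
  and keeps the conditions of \<open>M\<close>, so uniqueness identifies the rest.\<close>

lemma hermite_poly_newton:
  "hermite_poly df (add_mset b M) = hermite_poly df M + smult (divdiff df (add_mset b M)) (node_poly M)"
proof -
  define p where "p = hermite_poly df (add_mset b M)"
  have p: "is_hermite df (add_mset b M) p" unfolding p_def by (rule is_hermite_hermite_poly)
  have "is_hermite df M (p - smult (coeff p (size M)) (node_poly M))"
    unfolding is_hermite_def
  proof (intro conjI allI impI)
    fix i assume "size M \<le> i"
    then consider "i = size M" | "size M < i" by linarith
    then show "coeff (p - smult (coeff p (size M)) (node_poly M)) i = 0"
      by cases (use p in \<open>simp_all add: is_hermite_def node_poly_degree coeff_eq_0\<close>)
  next
    fix z i assume "i < count M z"
    then show "poly ((pderiv ^^ i) (p - smult (coeff p (size M)) (node_poly M))) z = df i z"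
      using p by (simp add: is_hermite_def higher_pderiv_diff higher_pderiv_smult node_poly_vanishes)
  qed
  from hermite_poly_eqI[OF this] show ?thesis by (simp add: p_def divdiff_def)
qed

lemma poly_hermite_poly_node: "z \<in># M \<Longrightarrow> poly (hermite_poly df M) z = df 0 z"
proof -
  assume "z \<in># M"
  then have "0 < count M z" by simp
  with is_hermite_hermite_poly[of df M] have "poly ((pderiv ^^ 0) (hermite_poly df M)) z = df 0 z"
    unfolding is_hermite_def by blast
  then show ?thesis by simp
qed

text \<open>The interpolant at \<open>N\<close> with \<open>a\<close> and \<open>b\<close> has two
  Newton forms, according to which of the two comes last. Their coefficients at
  \<open>size N\<close> are compared; there the node polynomials differ only by the summands
  \<open>- a\<close> and \<open>- b\<close>. Without division the identity also holds for
  \<open>a = b\<close>.\<close>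

lemma divdiff_recursion:
  "(a - b) * divdiff df (add_mset a (add_mset b N)) = divdiff df (add_mset a N) - divdiff df (add_mset b N)"
proof -
  define D where "D = divdiff df (add_mset a (add_mset b N))"
  have "hermite_poly df (add_mset a N) + smult D (node_poly (add_mset a N)) =
        hermite_poly df (add_mset b N) + smult D (node_poly (add_mset b N))"
    unfolding D_def
    by (metis add_mset_commute hermite_poly_newton)
  then have "coeff (hermite_poly df (add_mset a N)) (size N) + D * coeff (node_poly (add_mset a N)) (size N) =
     coeff (hermite_poly df (add_mset b N)) (size N) + D * coeff (node_poly (add_mset b N)) (size N)"
    by (metis coeff_add coeff_smult)
  moreover have "coeff (node_poly (add_mset c N)) (size N) = (case size N of 0 \<Rightarrow> 0 | Suc n \<Rightarrow> coeff (node_poly N) n) - c" for c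
    using node_poly_degree(2)[of N] by (simp add: coeff_pCons split: nat.split)
  ultimately have "coeff (hermite_poly df (add_mset a N)) (size N) - D * a =
     coeff (hermite_poly df (add_mset b N)) (size N) - D * b"
    by (simp only: right_diff_distrib)
  then show ?thesis
    by (simp add: divdiff_def[of df "add_mset _ N"] D_def algebra_simps)
qed

text \<open>On a sorted sequence, equal values at positions i and l force a block of l - i + 1 equal nodes,
  so the hypothesis on u says that u 0 vanishes at the nodes counted with multiplicity.\<close>
lemma generalized_rolle:
  fixes u :: "nat \<Rightarrow> real \<Rightarrow> real" and z :: "nat \<Rightarrow> real"
  assumes "\<And>i t. i < j \<Longrightarrow> t \<in> {a..b} \<Longrightarrow> (u i has_real_derivative u (Suc i) t) (at t within {a..b})"
    and "\<And>i. i < j \<Longrightarrow> z i \<le> z (Suc i)"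
    and "\<And>i. i \<le> j \<Longrightarrow> z i \<in> {a..b}"
    and "\<And>i l. i \<le> l \<Longrightarrow> l \<le> j \<Longrightarrow> z i = z l \<Longrightarrow> u (l - i) (z l) = 0"
  shows "\<exists>\<xi>\<in>{a..b}. u j \<xi> = 0"
  using assms
proof (induction j arbitrary: u z)
  case 0
  from "0.prems"(4)[of 0 0] "0.prems"(3)[of 0] show ?case by auto
next
  case (Suc j)
  have mono: "i \<le> l \<Longrightarrow> l \<le> Suc j \<Longrightarrow> z i \<le> z l" for i l
  proof (induction l)
    case (Suc l)
    then show ?case using Suc.prems \<open>\<And>i. i < Suc j \<Longrightarrow> z i \<le> z (Suc i)\<close>[of l]
      by (cases "i = Suc l") auto
  qed simp
  \<comment> \<open>Between distinct neighbours the new point is a Rolle point strictly inside;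
    between equal neighbours it is the node itself. Strictness ensures that new points coincide only
    inside a block of equal old ones, whose length then drops by one.\<close>
  define Q where "Q i y \<longleftrightarrow> z i \<le> y \<and> y \<le> z (Suc i) \<and> (z i = z (Suc i) \<longrightarrow> y = z i)
      \<and> (z i < z (Suc i) \<longrightarrow> z i < y \<and> y < z (Suc i) \<and> u 1 y = 0)" for i y
  have "\<exists>y. Q i y" if i: "i \<le> j" for i
  proof (cases "z i = z (Suc i)")
    case False
    then have lt: "z i < z (Suc i)" using mono[of i "Suc i"] i by simp
    have in_ab: "a \<le> z i" "z (Suc i) \<le> b" using Suc.prems(3)[of i] Suc.prems(3)[of "Suc i"] i by auto
    have d: "(u 0 has_real_derivative u 1 t) (at t within {a..b})" if "t \<in> {a..b}" for t
      using Suc.prems(1)[of 0 t] that by simp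
    have interior: "(u 0 has_real_derivative u 1 t) (at t)" if t: "a < t" "t < b" for t
    proof -
      have "t \<in> {a..b}" using t by simp
      from d[OF this] show ?thesis unfolding at_within_Icc_at[OF t] .
    qed
    have "\<exists>y. z i < y \<and> y < z (Suc i) \<and> (u 0 has_real_derivative 0) (at y)"
    proof (rule Rolle[OF lt])
      show "u 0 (z i) = u 0 (z (Suc i))"
        using Suc.prems(4)[of i i] Suc.prems(4)[of "Suc i" "Suc i"] i by simp
      have "continuous_on {a..b} (u 0)"
        using d by (meson DERIV_continuous continuous_on_eq_continuous_within)
      then show "continuous_on {z i..z (Suc i)} (u 0)"
        by (rule continuous_on_subset) (use in_ab in auto)
      fix t assume t: "z i < t" "t < z (Suc i)"
      have "(u 0 has_real_derivative u 1 t) (at t)"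
        by (rule interior) (use t in_ab in auto)
      then show "u 0 differentiable at t" using real_differentiable_def by blast
    qed
    then obtain y where y: "z i < y" "y < z (Suc i)" "(u 0 has_real_derivative 0) (at y)" by blast
    have "(u 0 has_real_derivative u 1 y) (at y)"
      by (rule interior) (use y in_ab in auto)
    then have "u 1 y = 0" using y DERIV_unique by blast
    then show ?thesis unfolding Q_def using y by (intro exI[of _ y]) auto
  qed (auto simp: Q_def)
  then have "\<exists>y. \<forall>i\<in>{..j}. Q i (y i)" by (intro bchoice) simp
  then obtain y where y: "\<And>i. i \<le> j \<Longrightarrow> z i \<le> y i \<and> y i \<le> z (Suc i) \<and> (z i = z (Suc i) \<longrightarrow> y i = z i)
      \<and> (z i < z (Suc i) \<longrightarrow> z i < y i \<and> y i < z (Suc i) \<and> u 1 (y i) = 0)"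
    unfolding Q_def by auto
  have "\<exists>\<xi>\<in>{a..b}. u (Suc j) \<xi> = 0"
  proof (rule Suc.IH[of "\<lambda>i. u (Suc i)" y])
    fix i t assume "i < j" "t \<in> {a..b}"
    then show "(u (Suc i) has_real_derivative u (Suc (Suc i)) t) (at t within {a..b})"
      using Suc.prems(1)[of "Suc i"] by simp
  next
    fix i assume "i < j"
    then show "y i \<le> y (Suc i)" using y[of i] y[of "Suc i"] by simp
  next
    fix i assume "i \<le> j"
    then show "y i \<in> {a..b}" using y[of i] Suc.prems(3)[of i] Suc.prems(3)[of "Suc i"] by simp
  next
    fix i l assume il: "i \<le> l" "l \<le> j" "y i = y l"
    show "u (Suc (l - i)) (y l) = 0"
    proof (cases "z i = z (Suc i)")
      case True
      then have yi: "y i = z i" using y[of i] il by simp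
      then have zl: "z l = z i" using y[of l] il mono[of i l] by simp
      then have "z (Suc l) = z i"
        using y[of l] il yi mono[of l "Suc l"] by force
      then show ?thesis
        using Suc.prems(4)[of i "Suc l"] il yi by (simp add: Suc_diff_le)
    next
      case False
      then have lt: "z i < y i" "y i < z (Suc i)" "u 1 (y i) = 0"
        using y[of i] il mono[of i "Suc i"] by auto
      have "l = i"
        using mono[of "Suc i" l] il y[of l] lt by (cases "l = i") auto
      then show ?thesis using lt by simp
    qed
  qed
  then show ?case .
qed

lemma sorted_nth_eq_imp_less_count:
  assumes "sorted zs" "i \<le> l" "l < length zs" "zs ! i = zs ! l"
  shows "l - i < count (mset zs) (zs ! l)"
proof -
  have "{i..l} \<subseteq> {p. p < length zs \<and> zs ! l = zs ! p}"
  proof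
    fix p assume p: "p \<in> {i..l}"
    then have "zs ! i \<le> zs ! p" "zs ! p \<le> zs ! l"
      using assms(1-3) by (auto intro: sorted_nth_mono)
    then show "p \<in> {p. p < length zs \<and> zs ! l = zs ! p}" using p assms by auto
  qed
  then have "card {i..l} \<le> card {p. p < length zs \<and> zs ! l = zs ! p}"
    by (rule card_mono[rotated]) simp
  then show ?thesis
    using assms by (simp add: count_mset count_list_eq_length_filter length_filter_conv_card)
qed

text \<open>The difference of \<open>df\<close> and its interpolant satisfies the hypotheses of the
  generalized Rolle theorem, and the \<open>j\<close>-th derivative of a polynomial of degree at
  most \<open>j\<close> is \<open>fact j\<close> times its top coefficient.\<close>

lemma divdiff_mvt:
  assumes der: "\<And>i t. i < j \<Longrightarrow> t \<in> {a..b} \<Longrightarrow> (df i has_real_derivative df (Suc i) t) (at t within {a..b})"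
    and sz: "size M = Suc j" and M: "set_mset M \<subseteq> {a..b}"
  shows "\<exists>\<xi>\<in>{a..b}. divdiff df M = df j \<xi> / fact j"
proof -
  define p where "p = hermite_poly df M"
  have p: "is_hermite df M p" unfolding p_def by (rule is_hermite_hermite_poly)
  define zs where "zs = sorted_list_of_multiset M"
  have zs: "sorted zs" "mset zs = M" "length zs = Suc j"
    using sz size_mset[of zs] by (simp_all add: zs_def)
  define u where "u i t = df i t - poly ((pderiv ^^ i) p) t" for i t
  have "\<exists>\<xi>\<in>{a..b}. u j \<xi> = 0"
  proof (rule generalized_rolle[of j a b u "\<lambda>i. zs ! i"])
    fix i t assume "i < j" "t \<in> {a..b}"
    then show "(u i has_real_derivative u (Suc i) t) (at t within {a..b})"
      unfolding u_def
      by (auto intro!: derivative_eq_intros der poly_DERIV[THEN DERIV_subset])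
  next
    fix i assume "i < j"
    then show "zs ! i \<le> zs ! Suc i" using zs by (auto intro: sorted_nth_mono)
  next
    fix i assume "i \<le> j"
    then have "zs ! i \<in> set zs" using zs by auto
    then show "zs ! i \<in> {a..b}" using M zs by (metis set_mset_mset subsetD)
  next
    fix i l assume il: "i \<le> l" "l \<le> j" "zs ! i = zs ! l"
    then have "l - i < count M (zs ! l)"
      using sorted_nth_eq_imp_less_count[of zs i l] zs by simp
    then show "u (l - i) (zs ! l) = 0" using p by (simp add: u_def is_hermite_def)
  qed
  then obtain \<xi> where \<xi>: "\<xi> \<in> {a..b}" "u j \<xi> = 0" by blast
  have "(pderiv ^^ j) p = [:fact j * coeff p j:]"
  proof (rule poly_eqI)
    fix i
    show "coeff ((pderiv ^^ j) p) i = coeff [:fact j * coeff p j:] i"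
      using p sz
      by (cases i) (simp_all add: coeff_higher_pderiv is_hermite_def pochhammer_fact)
  qed
  then have "df j \<xi> = fact j * coeff p j" using \<xi> by (simp add: u_def)
  then have "divdiff df M = df j \<xi> / fact j" by (simp add: divdiff_def p_def sz)
  then show ?thesis using \<xi> by blast
qed

section \<open>Finite differences and Marchaud's inequality\<close>

primrec fdiff :: "nat \<Rightarrow> real \<Rightarrow> (real \<Rightarrow> real) \<Rightarrow> real \<Rightarrow> real" where
  "fdiff 0 u g x = g x"
| "fdiff (Suc k) u g x = fdiff k u g (x + u) - fdiff k u g x"

definition fdiff_bound :: "nat \<Rightarrow> (real \<Rightarrow> real) \<Rightarrow> real \<Rightarrow> real \<Rightarrow> real \<Rightarrow> real \<Rightarrow> bool" where
  "fdiff_bound k g a b t W \<longleftrightarrow>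
     (\<forall>u x. 0 < u \<longrightarrow> u \<le> t \<longrightarrow> a \<le> x \<longrightarrow> x + real k * u \<le> b \<longrightarrow> \<bar>fdiff k u g x\<bar> \<le> W)"

lemma fdiff_boundD:
  "fdiff_bound k g a b t W \<Longrightarrow> 0 < u \<Longrightarrow> u \<le> t \<Longrightarrow> a \<le> x \<Longrightarrow> x + real k * u \<le> b \<Longrightarrow> \<bar>fdiff k u g x\<bar> \<le> W"
  unfolding fdiff_bound_def by blast

lemma fdiff_bound_mono:
  "fdiff_bound k g a b t W \<Longrightarrow> t' \<le> t \<Longrightarrow> W \<le> W' \<Longrightarrow> fdiff_bound k g a b t' W'"
  unfolding fdiff_bound_def by (meson order_trans)

lemma fdiff_diff: "fdiff k u (\<lambda>t. g t - h t) x = fdiff k u g x - fdiff k u h x"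
  by (induction k arbitrary: x) simp_all

lemma fdiff_neg: "fdiff k u (\<lambda>t. - h t) x = - fdiff k u h x"
  by (induction k arbitrary: x) simp_all

lemma fdiff_shift: "fdiff k u (\<lambda>t. g (t + s)) x = fdiff k u g (x + s)"
  by (induction k arbitrary: x) (simp_all add: algebra_simps)

lemma fdiff_fdiff_1: "fdiff k u (fdiff 1 u g) x = fdiff (Suc k) u g x"
proof (induction k arbitrary: x)
  case (Suc k)
  show ?case unfolding fdiff.simps(2)[of k u "fdiff 1 u g"] Suc by simp
qed simp

text \<open>Lets a difference be read from its right end point, for use where an interval can be
  extended only to the left.\<close>

lemma fdiff_uminus: "fdiff k (- u) g x = (- 1) ^ k * fdiff k u g (x - real k * u)"
  by (induction k arbitrary: x) (simp_all add: algebra_simps)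

lemma fdiff_abs_le:
  "(\<And>i. i \<le> k \<Longrightarrow> \<bar>g (x + real i * u)\<bar> \<le> A) \<Longrightarrow> \<bar>fdiff k u g x\<bar> \<le> 2 ^ k * A"
proof (induction k arbitrary: x)
  case 0
  from "0"[of 0] show ?case by simp
next
  case (Suc k)
  have "\<bar>fdiff k u g x\<bar> \<le> 2 ^ k * A"
    using Suc.prems by (intro Suc.IH) auto
  moreover have "\<bar>fdiff k u g (x + u)\<bar> \<le> 2 ^ k * A"
  proof (rule Suc.IH)
    fix i assume "i \<le> k"
    then show "\<bar>g (x + u + real i * u)\<bar> \<le> A"
      using Suc.prems[of "Suc i"] by (simp add: algebra_simps)
  qed
  ultimately show ?case by simp
qed

lemma fdiff_bound_trivial:
  assumes M: "\<And>y. y \<in> {a..b} \<Longrightarrow> \<bar>g y\<bar> \<le> M"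
  shows "fdiff_bound j g a b t (2 ^ j * M)"
  unfolding fdiff_bound_def
proof (intro allI impI)
  fix u x assume u: "0 < u" "u \<le> t" "a \<le> x" "x + real j * u \<le> b"
  show "\<bar>fdiff j u g x\<bar> \<le> 2 ^ j * M"
  proof (rule fdiff_abs_le)
    fix i assume "i \<le> j"
    then have "real i * u \<le> real j * u" "0 \<le> real i * u"
      using u by (simp_all add: mult_right_mono)
    then have "a \<le> x + real i * u" "x + real i * u \<le> b" using u by linarith+
    then show "\<bar>g (x + real i * u)\<bar> \<le> M" by (intro M) simp
  qed
qed

text \<open>The last value enters a difference with coefficient 1, and the absolute values of the
  other coefficients add up to less than \<open>2 ^ k\<close>.\<close>

lemma fdiff_last_value:
  "0 \<le> A \<Longrightarrow> (\<And>i. i < k \<Longrightarrow> \<bar>g (x + real i * u)\<bar> \<le> A) \<Longrightarrow> \<bar>g (x + real k * u) - fdiff k u g x\<bar> \<le> 2 ^ k * A"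
proof (induction k arbitrary: x)
  case (Suc k)
  have "\<bar>fdiff k u g x\<bar> \<le> 2 ^ k * A"
    using Suc.prems by (intro fdiff_abs_le) auto
  moreover have "\<bar>g (x + u + real k * u) - fdiff k u g (x + u)\<bar> \<le> 2 ^ k * A"
  proof (rule Suc.IH[OF Suc.prems(1)])
    fix i assume "i < k"
    then show "\<bar>g (x + u + real i * u)\<bar> \<le> A"
      using Suc.prems(2)[of "Suc i"] by (simp add: algebra_simps)
  qed
  ultimately show ?case by (simp add: algebra_simps)
qed simp

text \<open>A first difference lowers the degree, because \<open>p\<close> and its translate have
  the same leading coefficient.\<close>

lemma fdiff_poly: "(\<And>i. k \<le> i \<Longrightarrow> coeff p i = 0) \<Longrightarrow> fdiff k u (poly p) x = 0"
proof (induction k arbitrary: p)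
  case 0
  then have "p = 0" by (simp add: poly_eq_iff)
  then show ?case by simp
next
  case (Suc k)
  define q where "q = pcompose p [:u, 1:] - p"
  have q: "fdiff 1 u (poly p) = poly q"
    by (rule ext) (simp add: q_def poly_pcompose add.commute)
  have "coeff q i = 0" if "k \<le> i" for i
  proof (cases "p = 0")
    case False
    have deg: "degree p \<le> k" using Suc.prems by (meson degree_le leI le_SucI not_less_eq_eq less_imp_le Suc_leI)
    have 1: "degree (pcompose p [:u, 1:]) = degree p" by (simp add: degree_pcompose)
    have 2: "lead_coeff (pcompose p [:u, 1:]) = lead_coeff p" by (subst lead_coeff_comp) simp_all
    show ?thesis
    proof (cases "i = degree p")
      case True
      then show ?thesis using 1 2 by (simp add: q_def)
    next
      case False
      then have "degree p < i" using that deg by simp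
      then show ?thesis using 1 by (simp add: q_def coeff_eq_0)
    qed
  qed (simp add: q_def)
  then have "fdiff k u (poly q) x = 0" by (rule Suc.IH)
  then show ?case using fdiff_fdiff_1[of k u "poly p" x] q by simp
qed

text \<open>With T the translation by u, the step 2u gives T^2 - 1 = (T + 1)(T - 1). Hence the
  expression is (T + 1)^j - 2^j applied to the j-th difference. This operator is a multiple of T -
  1, which raises the order by one; the cofactor has degree below j and coefficient sum j 2^(j - 1),
  so the stated bound is generous.\<close>

lemma fdiff_double:
  "(\<And>l. l < j \<Longrightarrow> \<bar>fdiff (Suc j) u g (x + real l * u)\<bar> \<le> W) \<Longrightarrow>
    \<bar>fdiff j (2 * u) g x - 2 ^ j * fdiff j u g x\<bar> \<le> real j * 2 ^ j * W"
proof (induction j arbitrary: g x)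
  case (Suc j)
  have W: "0 \<le> W" using Suc.prems[of 0] by simp
  define h where "h = fdiff 1 u g"
  have h: "fdiff i u h y = fdiff (Suc i) u g y" for i y
    unfolding h_def by (rule fdiff_fdiff_1)
  have IH0: "\<bar>fdiff j (2 * u) h x - 2 ^ j * fdiff j u h x\<bar> \<le> real j * 2 ^ j * W"
  proof (rule Suc.IH)
    fix l assume "l < j"
    then show "\<bar>fdiff (Suc j) u h (x + real l * u)\<bar> \<le> W"
      unfolding h using Suc.prems by simp
  qed
  have IH1: "\<bar>fdiff j (2 * u) h (x + u) - 2 ^ j * fdiff j u h (x + u)\<bar> \<le> real j * 2 ^ j * W"
  proof (rule Suc.IH)
    fix l assume "l < j"
    then show "\<bar>fdiff (Suc j) u h (x + u + real l * u)\<bar> \<le> W"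
      unfolding h using Suc.prems[of "Suc l"] by (simp add: algebra_simps)
  qed
  have "fdiff (Suc j) (2 * u) g x = fdiff j (2 * u) (\<lambda>t. g (t + 2 * u) - g t) x"
    by (simp add: fdiff_diff fdiff_shift)
  also have "(\<lambda>t. g (t + 2 * u) - g t) = (\<lambda>t. h (t + u) - (- h t))"
    by (simp add: h_def algebra_simps)
  also have "fdiff j (2 * u) \<dots> x = fdiff j (2 * u) h (x + u) + fdiff j (2 * u) h x"
    unfolding fdiff_diff fdiff_neg fdiff_shift by simp
  finally have eq: "fdiff (Suc j) (2 * u) g x = fdiff j (2 * u) h (x + u) + fdiff j (2 * u) h x" .
  have "\<bar>fdiff j u h (x + u) - fdiff j u h x\<bar> \<le> W"
    using Suc.prems[of 0] unfolding h by simp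
  then have "2 ^ j * \<bar>fdiff j u h (x + u) - fdiff j u h x\<bar> \<le> 2 ^ j * W"
    by (intro mult_left_mono) auto
  then have "\<bar>2 ^ j * fdiff j u h (x + u) - 2 ^ j * fdiff j u h x\<bar> \<le> 2 ^ j * W"
    by (simp add: abs_mult flip: right_diff_distrib)
  moreover have "0 \<le> 2 ^ j * W" using W by simp
  moreover have "2 ^ Suc j * fdiff (Suc j) u g x = 2 * (2 ^ j * fdiff j u h x)"
    unfolding h by simp
  moreover have "real (Suc j) * 2 ^ Suc j * W = 2 * (real j * 2 ^ j * W) + 2 * (2 ^ j * W)"
    by (simp add: algebra_simps)
  ultimately show ?case
    using IH0 IH1 unfolding eq by linarith
qed simp

text \<open>One of the two intervals obtained by extending [x, x + j u] by its own length to the right or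
  to the left lies in [a, b], because 3 j u \<le> b - a.\<close>
lemma fdiff_bound_step:
  assumes "fdiff_bound j g a b (2 * t) V" "fdiff_bound (Suc j) g a b t W"
    and "3 * real j * t \<le> b - a" "0 < t" "0 < j" "0 \<le> W"
  shows "fdiff_bound j g a b t (V / 2 ^ j + real j * W)"
  unfolding fdiff_bound_def
proof (intro allI impI)
  fix u x assume u: "0 < u" "u \<le> t" and x: "a \<le> x" "x + real j * u \<le> b"
  have ju: "real j * u \<le> real j * t" using u by (simp add: mult_left_mono)
  have key: "\<bar>D2 - 2 ^ j * D\<bar> \<le> real j * 2 ^ j * W \<Longrightarrow> \<bar>D2\<bar> \<le> V \<Longrightarrow> \<bar>D\<bar> \<le> V / 2 ^ j + real j * W" for D D2 :: real
  proof -
    assume "\<bar>D2 - 2 ^ j * D\<bar> \<le> real j * 2 ^ j * W" "\<bar>D2\<bar> \<le> V"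
    then have "\<bar>2 ^ j * D\<bar> \<le> V + real j * 2 ^ j * W" by linarith
    then show ?thesis by (simp add: abs_mult field_simps)
  qed
  have lu: "real l * u \<le> real j * u - u" if "l < j" for l
  proof -
    have "real l * u \<le> (real j - 1) * u" using that u by (intro mult_right_mono) auto
    then show ?thesis by (simp add: algebra_simps)
  qed
  show "\<bar>fdiff j u g x\<bar> \<le> V / 2 ^ j + real j * W"
  proof (cases "x + 2 * (real j * u) \<le> b")
    case True
    show ?thesis
    proof (rule key)
      show "\<bar>fdiff j (2 * u) g x\<bar> \<le> V"
        using True u x by (intro fdiff_boundD[OF assms(1)]) auto
      show "\<bar>fdiff j (2 * u) g x - 2 ^ j * fdiff j u g x\<bar> \<le> real j * 2 ^ j * W"
      proof (rule fdiff_double)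
        fix l assume "l < j"
        have "0 \<le> real l * u" using u by simp
        then have "a \<le> x + real l * u" using x by linarith
        moreover have "x + real l * u + real (Suc j) * u \<le> b"
          using lu[OF \<open>l < j\<close>] True by (simp add: algebra_simps)
        ultimately show "\<bar>fdiff (Suc j) u g (x + real l * u)\<bar> \<le> W"
          using u by (intro fdiff_boundD[OF assms(2)])
      qed
    qed
  next
    case False
    then have left: "a \<le> x - real j * u" using assms(3) ju by linarith
    define y where "y = x + real j * u"
    have "\<bar>fdiff j (- u) g y\<bar> \<le> V / 2 ^ j + real j * W"
    proof (rule key)
      have "\<bar>fdiff j (2 * u) g (y - real j * (2 * u))\<bar> \<le> V"
        using left u x by (intro fdiff_boundD[OF assms(1)]) (auto simp: y_def algebra_simps)
      then show "\<bar>fdiff j (2 * - u) g y\<bar> \<le> V"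
        using fdiff_uminus[of j "2 * u" g y] by (simp add: abs_mult)
      show "\<bar>fdiff j (2 * - u) g y - 2 ^ j * fdiff j (- u) g y\<bar> \<le> real j * 2 ^ j * W"
      proof (rule fdiff_double)
        fix l assume "l < j"
        have "0 \<le> real l * u" using u by simp
        then have "y - real l * u - real (Suc j) * u + real (Suc j) * u \<le> b"
          using x by (simp add: y_def)
        moreover have "a \<le> y - real l * u - real (Suc j) * u"
          using lu[OF \<open>l < j\<close>] left by (simp add: y_def algebra_simps)
        ultimately have "\<bar>fdiff (Suc j) u g (y - real l * u - real (Suc j) * u)\<bar> \<le> W"
          using u by (intro fdiff_boundD[OF assms(2)])
        then show "\<bar>fdiff (Suc j) (- u) g (y + real l * - u)\<bar> \<le> W"
          using fdiff_uminus[of "Suc j" u g "y - real l * u"] by (simp add: abs_mult del: fdiff.simps)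
      qed
    qed
    then show ?thesis
      using fdiff_uminus[of j u g y] by (simp add: abs_mult y_def)
  qed
qed

text \<open>Closed form: the sum of q^(e - i) V(i) over 1 \<le> i \<le> e, plus q^e M. It collects
  the bounds obtained when the step is halved e times.\<close>

primrec geom_sum :: "real \<Rightarrow> real \<Rightarrow> (nat \<Rightarrow> real) \<Rightarrow> nat \<Rightarrow> real" where
  "geom_sum q M V 0 = M"
| "geom_sum q M V (Suc e) = V (Suc e) + q * geom_sum q M V e"

lemma geom_sum_nonneg: "0 \<le> q \<Longrightarrow> 0 \<le> M \<Longrightarrow> (\<And>e. 0 \<le> V e) \<Longrightarrow> 0 \<le> geom_sum q M V e"
  by (induction e) simp_all

lemma geom_sum_ge: "0 \<le> q \<Longrightarrow> 0 \<le> M \<Longrightarrow> (\<And>e. 0 \<le> V e) \<Longrightarrow> V (Suc e) \<le> geom_sum q M V (Suc e)"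
  by (simp add: geom_sum_nonneg)

text \<open>The loss in lowering the order of the difference by one: \<open>real k * 2 ^ k\<close>
  is a generous bound for the factor met when the step is halved, and the 2 comes from replacing
  \<open>2 * S e - R e\<close> by \<open>2 * S e\<close>.\<close>

definition marchaud_factor :: "nat \<Rightarrow> real" where
  "marchaud_factor k = 2 * real k * 2 ^ k"

text \<open>The outer induction lowers the order, the inner one halves the step by
  \<open>fdiff_bound_step\<close>. Order j contracts by 1 / 2^j per halving, while the forcing term
  from order j + 1 is a geometric sum with the smaller ratio 1 / 2^(j + 1). Because of this gap the
  two sums merge into one of ratio 1 / 2^j, with a factor that does not depend on e.\<close>

lemma marchaud_scales:
  assumes T: "0 < T" "3 * real k * T \<le> b - a" and k: "0 < k"
    and M: "\<And>y. y \<in> {a..b} \<Longrightarrow> \<bar>g y\<bar> \<le> M" "0 \<le> M"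
    and V: "\<And>e. 0 \<le> V e" "\<And>e. 0 < e \<Longrightarrow> fdiff_bound k g a b (T / 2 ^ e) (V e)"
  shows "i < k \<Longrightarrow> fdiff_bound (k - i) g a b (T / 2 ^ e)
     (marchaud_factor k ^ i * 2 ^ k * geom_sum (1 / 2 ^ (k - i)) M V e)"
proof (induction i arbitrary: e)
  case 0
  show ?case
  proof (cases e)
    case 0
    then show ?thesis using fdiff_bound_trivial[of a b g M k T] M by simp
  next
    case (Suc e')
    have "V e \<le> geom_sum (1 / 2 ^ k) M V e" unfolding Suc using M V by (intro geom_sum_ge) auto
    also have "\<dots> \<le> 2 ^ k * geom_sum (1 / 2 ^ k) M V e"
      using M V geom_sum_nonneg[of "1 / 2 ^ k" M V e] by (simp add: mult_le_cancel_right1)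
    finally show ?thesis
      using Suc V(2)[of e] by (auto intro: fdiff_bound_mono)
  qed
next
  case (Suc i)
  define j where "j = k - Suc i"
  have j: "0 < j" "j < k" "k - i = Suc j" using Suc.prems by (auto simp: j_def)
  define B where "B = marchaud_factor k ^ i * 2 ^ k"
  define B' where "B' = real k * 2 ^ k * B"
  have mf: "1 \<le> marchaud_factor k"
    using k mult_mono[of 1 "real k" 1 "2 ^ k :: real"] by (simp add: marchaud_factor_def)
  have B1: "2 ^ k \<le> B" using mf by (simp add: B_def)
  have Bpos: "0 < B" using B1 by (smt (verit) zero_less_power)
  have kk: "real k * 1 \<le> real k * 2 ^ k" by (intro mult_left_mono) auto
  have B'B: "real j * B \<le> B'"
    unfolding B'_def using order_trans[OF _ kk, of "real j"] j Bpos by (intro mult_right_mono) auto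
  have "B \<le> B'" unfolding B'_def using k Bpos mult_mono[of 1 "real k" 1 "2 ^ k :: real"] by simp
  have "(2::real) ^ j \<le> 2 ^ k" using j by (intro power_increasing) auto
  then have B'2: "2 ^ j \<le> B'" using B1 \<open>B \<le> B'\<close> by linarith
  define S where "S = geom_sum (1 / 2 ^ j) M V"
  define R where "R = geom_sum (1 / 2 ^ Suc j) M V"
  have R0: "0 \<le> R e" for e unfolding R_def using M V by (intro geom_sum_nonneg) auto
  have IH: "fdiff_bound (Suc j) g a b (T / 2 ^ e) (B * R e)" for e
    using Suc.IH[of e] Suc.prems unfolding R_def B_def j(3) by (simp add: mult.assoc)
  \<comment> \<open>2 S - R is chosen so that B' (2 S - R) solves the recursion of the step lemma with forcing term B' R exactly.\<close>
  have main: "fdiff_bound j g a b (T / 2 ^ e) (B' * (2 * S e - R e))" for e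
  proof (induction e)
    case 0
    have "2 ^ j * M \<le> B' * M" using B'2 M by (intro mult_right_mono) auto
    then show ?case using fdiff_bound_mono[OF fdiff_bound_trivial[of a b g M j T]] M by (simp add: S_def R_def)
  next
    case (Suc e)
    have "fdiff_bound j g a b (T / 2 ^ Suc e) (B' * (2 * S e - R e) / 2 ^ j + real j * (B * R (Suc e)))"
    proof (rule fdiff_bound_step)
      show "fdiff_bound j g a b (2 * (T / 2 ^ Suc e)) (B' * (2 * S e - R e))" using Suc by simp
      have "(1::real) \<le> 2 ^ Suc e" by (rule one_le_power) simp
      then have "T / 2 ^ Suc e \<le> T" using T by (simp add: field_simps)
      then have "3 * real j * (T / 2 ^ Suc e) \<le> 3 * real k * T"
        using j T by (intro mult_mono) auto
      then show "3 * real j * (T / 2 ^ Suc e) \<le> b - a" using T by simp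
    qed (use IH[of "Suc e"] T j R0 Bpos in simp_all)
    moreover have "B' * (2 * S e - R e) / 2 ^ j + real j * (B * R (Suc e)) \<le> B' * (2 * S (Suc e) - R (Suc e))"
    proof -
      have "real j * (B * R (Suc e)) \<le> B' * R (Suc e)"
        using mult_right_mono[OF B'B R0[of "Suc e"]] by (simp add: mult.assoc)
      moreover have "B' * (2 * S e - R e) / 2 ^ j + B' * R (Suc e) = B' * (2 * S (Suc e) - R (Suc e))"
        by (simp add: S_def R_def field_simps)
      ultimately show ?thesis by linarith
    qed
    ultimately show ?case by (rule fdiff_bound_mono[OF _ order_refl])
  qed
  have "0 \<le> B' * R e" using R0[of e] Bpos \<open>B \<le> B'\<close> by simp
  then have "B' * (2 * S e - R e) \<le> 2 * B' * S e" by (simp add: algebra_simps)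
  also have "2 * B' * S e = marchaud_factor k ^ Suc i * 2 ^ k * S e"
    by (simp add: B'_def B_def marchaud_factor_def)
  finally show ?case
    unfolding S_def j_def[symmetric] by (rule fdiff_bound_mono[OF main[of e, unfolded S_def] order_refl])
qed

text \<open>Only monotonicity of \<open>w\<close> is at hand, so integrability comes from the second
  mean value theorem, applied to the monotone \<open>w\<close> and the continuous weight.\<close>

lemma mono_div_square_integrable:
  fixes w :: "real \<Rightarrow> real"
  assumes w: "\<And>s t. 0 < s \<Longrightarrow> s \<le> t \<Longrightarrow> w s \<le> w t" and c: "0 < c"
  shows "(\<lambda>u. w u / u\<^sup>2) integrable_on {c..d}"
proof (cases "c \<le> d")
  case True
  have "(\<lambda>u::real. 1 / u\<^sup>2) integrable_on {c..d}"
    using c by (intro integrable_continuous_real continuous_intros) auto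
  with True obtain y where "((\<lambda>u. w u *\<^sub>R (1 / u\<^sup>2)) has_integral y) {c..d}"
    using second_mean_value_theorem_full[of "\<lambda>u. 1 / u\<^sup>2" c d w] w c by force
  then have "(\<lambda>u. w u *\<^sub>R (1 / u\<^sup>2)) integrable_on {c..d}" by blast
  then show ?thesis by simp
qed (simp add: integrable_on_empty)

text \<open>Trades a value of \<open>w\<close> for an integral over one dyadic block: there the
  integrand is at least w(c) / (2c)^2, and the block has length c.\<close>

lemma mono_div_square_integral_ge:
  fixes w :: "real \<Rightarrow> real"
  assumes w: "\<And>s t. 0 < s \<Longrightarrow> s \<le> t \<Longrightarrow> w s \<le> w t" "\<And>t. 0 < t \<Longrightarrow> 0 \<le> w t" and c: "0 < c"
  shows "w c / (4 * c) \<le> integral {c..2 * c} (\<lambda>u. w u / u\<^sup>2)"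
proof -
  have "integral {c..2 * c} (\<lambda>u. w c / (4 * c\<^sup>2)) \<le> integral {c..2 * c} (\<lambda>u. w u / u\<^sup>2)"
  proof (rule integral_le)
    fix u assume u: "u \<in> {c..2 * c}"
    then have "u\<^sup>2 \<le> (2 * c)\<^sup>2" using c by (intro power_mono) auto
    then show "w c / (4 * c\<^sup>2) \<le> w u / u\<^sup>2"
      using u c w by (intro frac_le) (auto simp: power_mult_distrib)
  qed (use w c in \<open>auto intro: mono_div_square_integrable integrable_const_ivl\<close>)
  then show ?thesis using c by (simp add: power2_eq_square)
qed

lemma mono_div_square_integral_subset:
  fixes w :: "real \<Rightarrow> real"
  assumes w: "\<And>s t. 0 < s \<Longrightarrow> s \<le> t \<Longrightarrow> w s \<le> w t" "\<And>t. 0 < t \<Longrightarrow> 0 \<le> w t"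
    and c: "0 < c" "c \<le> c'" "d' \<le> d"
  shows "integral {c'..d'} (\<lambda>u. w u / u\<^sup>2) \<le> integral {c..d} (\<lambda>u. w u / u\<^sup>2)"
  using w c by (intro integral_subset_le mono_div_square_integrable) auto

lemma dyadic_scale_exists:
  fixes t c :: real
  assumes "0 < t" "t \<le> c"
  shows "\<exists>e. t * 2 ^ e \<le> c \<and> c < t * 2 ^ Suc e"
proof -
  obtain n where "c / t < 2 ^ n" using real_arch_pow[of 2 "c / t"] by auto
  then have ex: "\<exists>n. c < t * 2 ^ n" using assms by (auto simp: field_simps)
  define n where "n = (LEAST n. c < t * 2 ^ n)"
  have n: "c < t * 2 ^ n" unfolding n_def by (rule LeastI_ex[OF ex])
  then obtain e where e: "n = Suc e" using assms by (cases n) auto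
  have "\<not> c < t * 2 ^ e" using e unfolding n_def by (intro not_less_Least) auto
  then show ?thesis using n e by (auto simp: not_less)
qed

text \<open>The prefactor in \<open>marchaud_scales\<close> at \<open>i = k - 1\<close>, where the
  order has come down to 1.\<close>

definition marchaud_const :: "nat \<Rightarrow> real" where
  "marchaud_const k = marchaud_factor k ^ (k - 1) * 2 ^ k"

lemma marchaud_const_ge_1: "0 < k \<Longrightarrow> 1 \<le> marchaud_const k"
proof -
  assume k: "0 < k"
  then have "1 \<le> marchaud_factor k"
    using mult_mono[of 1 "real k" 1 "2 ^ k :: real"] by (simp add: marchaud_factor_def)
  then have "1 * 1 \<le> marchaud_factor k ^ (k - 1) * (2 ^ k :: real)"
    by (intro mult_mono one_le_power) auto
  then show ?thesis by (simp add: marchaud_const_def)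
qed

text \<open>Isolates what is needed of a modulus of smoothness. As \<open>w\<close> is only a
  majorant, the same \<open>w\<close> serves after a polynomial with vanishing \<open>k\<close>-th
  differences has been subtracted from \<open>g\<close>.\<close>

locale smoothness_majorant =
  fixes k :: nat and g :: "real \<Rightarrow> real" and a b :: real and w :: "real \<Rightarrow> real"
  assumes k: "0 < k" and ab: "a < b"
    and w_mono: "\<And>s t. 0 < s \<Longrightarrow> s \<le> t \<Longrightarrow> w s \<le> w t"
    and w_nonneg: "\<And>t. 0 < t \<Longrightarrow> 0 \<le> w t"
    and w_bound: "\<And>t. 0 < t \<Longrightarrow> fdiff_bound k g a b t (w t)"
begin

abbreviation tail :: "real \<Rightarrow> real" where
  "tail t \<equiv> integral {t..2 * (b - a)} (\<lambda>u. w u / u\<^sup>2)"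

text \<open>The first form, without an integral, is meant for Whitney's inequality, the second for
  the final estimate. They differ only in how the geometric sum of the values of \<open>w\<close> is
  bounded.\<close>

lemma marchaud:
  assumes M: "\<And>y. y \<in> {a..b} \<Longrightarrow> \<bar>g y\<bar> \<le> M" and t: "0 < t" "t \<le> b - a"
  shows "fdiff_bound 1 g a b t (marchaud_const k * (2 * w (b - a) + 6 * real k * (t / (b - a)) * M))" (is ?A)
    and "fdiff_bound 1 g a b t (marchaud_const k * (4 * t * tail t + 6 * real k * (t / (b - a)) * M))" (is ?B)
proof -
  have M0: "0 \<le> M" using M[of a] ab by force
  \<comment> \<open>The largest scale that \<open>marchaud_scales\<close> admits.\<close>
  define c where "c = (b - a) / (3 * real k)"
  have c: "0 < c" "b - a = 3 * real k * c" using k ab by (auto simp: c_def)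
  have "1 * c \<le> 3 * real k * c" using k c(1) by (intro mult_right_mono) auto
  then have c_le: "c \<le> b - a" using c(2) by simp
  have tail_nonneg: "0 \<le> tail t"
    using t w_nonneg by (intro integral_nonneg mono_div_square_integrable w_mono) auto
  have "?A \<and> ?B"
  proof (cases "t \<le> c")
    \<comment> \<open>Steps beyond \<open>c\<close> are comparable with the whole interval: the
      trivial bound \<open>2 * M\<close> fits into the last summand, because
      \<open>6 * real k * (c / (b - a)) = 2\<close>.\<close>
    case False
    have "2 * M = 2 * 3 * real k * (c / (b - a)) * M" using c k by simp
    also have "\<dots> \<le> 6 * real k * (t / (b - a)) * M"
      using False M0 ab by (intro mult_right_mono) (auto intro!: mult_left_mono divide_right_mono)
    finally have le: "2 * M \<le> 6 * real k * (t / (b - a)) * M" .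
    have "2 * M \<le> marchaud_const k * (r + 6 * real k * (t / (b - a)) * M)" if "0 \<le> r" for r
    proof -
      have "2 * M \<le> r + 6 * real k * (t / (b - a)) * M" using le that by simp
      also have "\<dots> \<le> marchaud_const k * \<dots>"
        using calculation M0 mult_right_mono[OF marchaud_const_ge_1[OF k], of "r + 6 * real k * (t / (b - a)) * M"]
        by simp
      finally show ?thesis .
    qed
    moreover have "0 \<le> 2 * w (b - a)" "0 \<le> 4 * t * tail t"
      using w_nonneg[of "b - a"] ab tail_nonneg t by auto
    moreover have "fdiff_bound 1 g a b t (2 * M)"
      using fdiff_bound_trivial[of a b g M 1 t] M by simp
    ultimately show ?thesis by (blast intro: fdiff_bound_mono)
  next
    case True
    from dyadic_scale_exists[OF t(1) True]
    obtain e where e: "t * 2 ^ e \<le> c" "c < t * 2 ^ Suc e" by blast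
    define T where "T = t * 2 ^ e"
    have T: "0 < T" "T \<le> c" "t = T / 2 ^ e" using t e by (auto simp: T_def)
    define V where "V = (\<lambda>i. w (T / 2 ^ i))"
    have V0: "0 \<le> V i" for i using T by (simp add: V_def w_nonneg)
    have "fdiff_bound (k - (k - 1)) g a b (T / 2 ^ e)
       (marchaud_factor k ^ (k - 1) * 2 ^ k * geom_sum (1 / 2 ^ (k - (k - 1))) M V e)"
    proof (rule marchaud_scales)
      show "3 * real k * T \<le> b - a" unfolding c(2) using T by (intro mult_left_mono) auto
      show "fdiff_bound k g a b (T / 2 ^ i) (V i)" for i
        using T by (auto simp: V_def intro: w_bound)
    qed (use T k M M0 V0 in auto)
    then have main: "fdiff_bound 1 g a b t (marchaud_const k * geom_sum (1 / 2) M V e)"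
      using k T by (simp add: marchaud_const_def)
    \<comment> \<open>The dyadic scale is maximal, so T is at least (b - a) / (6 k). Together with 1
      / 2^e = t / T this produces the factor 6 k.\<close>
    have "c / 2 \<le> T" using e(2) by (simp add: T_def)
    have "1 / 2 ^ e = t / T" using t by (simp add: T_def)
    also have "\<dots> \<le> t / (c / 2)"
      using \<open>c / 2 \<le> T\<close> T(1) c(1) t(1) by (intro divide_left_mono) simp_all
    also have "\<dots> = 6 * real k * (t / (3 * real k * c))" using k by simp
    also have "3 * real k * c = b - a" using c(2) by simp
    finally have "1 / 2 ^ e * M \<le> 6 * real k * (t / (b - a)) * M"
      by (rule mult_right_mono) (rule M0)
    then have "M / 2 ^ e \<le> 6 * real k * (t / (b - a)) * M" by simp
    \<comment> \<open>All values V are at most w(b - a), and the weights 1, 1/2, 1/4, ... add up to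
      less than 2.\<close>
    moreover have "geom_sum (1 / 2) M V i \<le> 2 * w (b - a) + M / 2 ^ i" for i
    proof (induction i)
      case (Suc i)
      have "T / 2 ^ Suc i \<le> T / 1" using T by (intro divide_left_mono) (auto simp del: power_Suc)
      then have "V (Suc i) \<le> w (b - a)" unfolding V_def using T c_le by (intro w_mono) auto
      then show ?case using Suc by simp
    qed (use w_nonneg[of "b - a"] ab in simp)
    \<comment> \<open>Each value w(s) is paid for by the integral over its own block from s to 2s.
      Halving the older part turns its prefactor 4 (2s) into 4 s, so that adjacent integrals
      join.\<close>
    moreover have "geom_sum (1 / 2) M V i \<le> 4 * (T / 2 ^ i) * integral {T / 2 ^ i..T} (\<lambda>u. w u / u\<^sup>2) + M / 2 ^ i" for i
    proof (induction i)
      case (Suc i)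
      define s where "s = T / 2 ^ Suc i"
      have s: "0 < s" "2 * s = T / 2 ^ i" "2 * s \<le> T"
        using T by (auto simp: s_def field_simps)
      have arith: "v \<le> p1 \<Longrightarrow> v' = v \<Longrightarrow> G \<le> 2 * p2 + m \<Longrightarrow> p = p1 + p2 \<Longrightarrow> m' = m / 2 \<Longrightarrow>
          v' + G / 2 \<le> p + m'" for v v' G p p1 p2 m m' :: real
        by linarith
      have combine: "integral {s..2 * s} (\<lambda>u. w u / u\<^sup>2) + integral {2 * s..T} (\<lambda>u. w u / u\<^sup>2)
          = integral {s..T} (\<lambda>u. w u / u\<^sup>2)"
        using s w_mono by (intro Henstock_Kurzweil_Integration.integral_combine mono_div_square_integrable) auto
      have "w s / (4 * s) \<le> integral {s..2 * s} (\<lambda>u. w u / u\<^sup>2)"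
        using s w_mono w_nonneg by (intro mono_div_square_integral_ge)
      then have "w s \<le> 4 * s * integral {s..2 * s} (\<lambda>u. w u / u\<^sup>2)"
        using s(1) by (simp add: field_simps)
      moreover have "V (Suc i) = w s" by (simp only: V_def s_def)
      moreover have "geom_sum (1 / 2) M V i \<le> 2 * (4 * s * integral {2 * s..T} (\<lambda>u. w u / u\<^sup>2)) + M / 2 ^ i"
        using Suc unfolding s(2)[symmetric] by simp
      moreover have "4 * s * integral {s..T} (\<lambda>u. w u / u\<^sup>2) = 4 * s * integral {s..2 * s} (\<lambda>u. w u / u\<^sup>2)
          + 4 * s * integral {2 * s..T} (\<lambda>u. w u / u\<^sup>2)"
        by (simp only: combine[symmetric] distrib_left)
      moreover have "M / 2 ^ Suc i = M / 2 ^ i / 2" by simp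
      ultimately have "V (Suc i) + geom_sum (1 / 2) M V i / 2
          \<le> 4 * s * integral {s..T} (\<lambda>u. w u / u\<^sup>2) + M / 2 ^ Suc i"
        by (rule arith)
      then show ?case by (simp add: s_def)
    qed simp
    from this[of e] have "geom_sum (1 / 2) M V e \<le> 4 * t * integral {t..T} (\<lambda>u. w u / u\<^sup>2) + M / 2 ^ e"
      using T by simp
    moreover have "integral {t..T} (\<lambda>u. w u / u\<^sup>2) \<le> tail t"
      using t T c_le ab w_mono w_nonneg by (intro mono_div_square_integral_subset) auto
    then have "4 * t * integral {t..T} (\<lambda>u. w u / u\<^sup>2) \<le> 4 * t * tail t"
      using t by (intro mult_left_mono) auto
    ultimately have "geom_sum (1 / 2) M V e \<le> 2 * w (b - a) + 6 * real k * (t / (b - a)) * M"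
      "geom_sum (1 / 2) M V e \<le> 4 * t * tail t + 6 * real k * (t / (b - a)) * M"
      by (meson add_left_mono order_trans, linarith)
    then show ?thesis
      using marchaud_const_ge_1[OF k]
      by (intro conjI fdiff_bound_mono[OF main order_refl] mult_left_mono) simp_all
  qed
  then show ?A ?B by auto
qed

end

section \<open>Whitney's inequality\<close>

text \<open>The number of grid steps: at least \<open>k\<close>, so that \<open>k\<close>
  interpolation points fit, and large enough that the supremum term of the Marchaud estimate at one
  grid step has a factor of at most 1/2.\<close>

definition whitney_grid :: "nat \<Rightarrow> nat" where
  "whitney_grid k = max k (nat \<lceil>12 * real k * marchaud_const k\<rceil>)"

text \<open>The growth along the grid plus the Marchaud term between grid points, doubled when half
  of the supremum is absorbed.\<close>

definition whitney_const :: "nat \<Rightarrow> real" where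
  "whitney_const k = 2 * ((2 ^ k + 1) ^ whitney_grid k + 2 * marchaud_const k)"

context smoothness_majorant
begin

lemma minus_poly:
  assumes "\<And>i. k \<le> i \<Longrightarrow> coeff P i = 0"
  shows "smoothness_majorant k (\<lambda>y. g y - poly P y) a b w"
  using k ab w_mono w_nonneg w_bound assms
  by unfold_locales (auto simp: fdiff_bound_def fdiff_diff fdiff_poly)

text \<open>The remainder g - P vanishes at the first k points of a fine uniform grid, so its k-th differences
  control it at all grid points; between grid points the Marchaud estimate costs at most half the
  supremum of the remainder, which can be absorbed.\<close>
lemma whitney:
  assumes cont: "continuous_on {a..b} g"
  shows "\<exists>P. (\<forall>i\<ge>k. coeff P i = 0) \<and>
    (\<forall>y\<in>{a..b}. \<bar>g y - poly P y\<bar> \<le> whitney_const k * w (b - a))"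
proof -
  define A where "A = marchaud_const k"
  have A: "1 \<le> A" unfolding A_def using k by (rule marchaud_const_ge_1)
  define N where "N = whitney_grid k"
  have N: "k \<le> N" "0 < N" "12 * real k * A \<le> real N"
    using k by (auto simp: N_def whitney_grid_def A_def le_max_iff_disj) linarith
  define W where "W = w (b - a)"
  have W: "0 \<le> W" using ab by (simp add: W_def w_nonneg)
  define \<delta> where "\<delta> = (b - a) / real N"
  have \<delta>: "0 < \<delta>" "real N * \<delta> = b - a" using ab N by (auto simp: \<delta>_def)
  have in_grid: "a + real i * \<delta> \<in> {a..b}" if "i \<le> N" for i
  proof -
    have "real i * \<delta> \<le> real N * \<delta>" using that \<delta> by (intro mult_right_mono) auto
    then show ?thesis using \<delta> by simp
  qed
  have \<delta>_le: "\<delta> \<le> b - a" using in_grid[of 1] N by simp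
  \<comment> \<open>The grid points are distinct, so only values of \<open>g\<close> are
    interpolated and one function can stand for all derivative orders.\<close>
  define X where "X = image_mset (\<lambda>i. a + real i * \<delta>) (mset_set {..<k})"
  define P where "P = hermite_poly (\<lambda>_. g) X"
  have P: "is_hermite (\<lambda>_. g) X P" unfolding P_def by (rule is_hermite_hermite_poly)
  have coeffs: "coeff P i = 0" if "k \<le> i" for i
    using P that by (simp add: is_hermite_def X_def)
  define E where "E y = g y - poly P y" for y
  interpret E: smoothness_majorant k E a b w
    unfolding E_def by (rule minus_poly) (rule coeffs)
  have "continuous_on {a..b} (\<lambda>y. \<bar>E y\<bar>)" unfolding E_def by (intro continuous_intros cont)
  from continuous_attains_sup[OF compact_Icc _ this] ab
  obtain y0 where y0: "y0 \<in> {a..b}" and sup: "\<And>y. y \<in> {a..b} \<Longrightarrow> \<bar>E y\<bar> \<le> \<bar>E y0\<bar>" by force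
  have E0: "E (a + real i * \<delta>) = 0" if "i < k" for i
    unfolding E_def P_def using that by (subst poly_hermite_poly_node) (auto simp: X_def)
  define K where "K = (2::real) ^ k + 1"
  have K: "1 \<le> K" by (simp add: K_def)
  \<comment> \<open>By \<open>fdiff_last_value\<close>, a value at a grid point costs
    \<open>2 ^ k\<close> times the bound for the \<open>k\<close> preceding ones, plus
    \<open>W\<close> for the difference itself; hence the growth factor \<open>K\<close> per grid
    point.\<close>
  have grid: "\<bar>E (a + real i * \<delta>)\<bar> \<le> K ^ i * W" if "i \<le> N" for i
    using that
  proof (induction i rule: less_induct)
    case (less i)
    show ?case
    proof (cases "i < k")
      case True
      then show ?thesis using E0 W K by simp
    next
      case False
      define l where "l = i - k"
      have l: "i = l + k" using False by (simp add: l_def)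
      define x where "x = a + real l * \<delta>"
      have x: "x + real n * \<delta> = a + real (l + n) * \<delta>" for n by (simp add: x_def algebra_simps)
      have prev: "\<bar>E (x + real n * \<delta>)\<bar> \<le> K ^ (i - 1) * W" if "n < k" for n
      proof -
        have "\<bar>E (x + real n * \<delta>)\<bar> \<le> K ^ (l + n) * W"
          unfolding x using that l less.prems by (intro less.IH) auto
        also have "\<dots> \<le> K ^ (i - 1) * W"
          using that l W K by (intro mult_right_mono power_increasing) auto
        finally show ?thesis .
      qed
      have "\<bar>E (x + real k * \<delta>) - fdiff k \<delta> E x\<bar> \<le> 2 ^ k * (K ^ (i - 1) * W)"
        using prev W K by (intro fdiff_last_value) auto
      moreover have "\<bar>fdiff k \<delta> E x\<bar> \<le> W"
        unfolding W_def
      proof (rule fdiff_boundD[OF E.w_bound])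
        show "x + real k * \<delta> \<le> b" unfolding x using in_grid[of i] less.prems l by simp
      qed (use ab \<delta> \<delta>_le in \<open>auto simp: x_def\<close>)
      moreover have "W \<le> K ^ (i - 1) * W" using W K by (simp add: mult_le_cancel_right1 one_le_power)
      moreover have "K ^ i * W = 2 ^ k * (K ^ (i - 1) * W) + K ^ (i - 1) * W"
      proof -
        have "K ^ i = K * K ^ (i - 1)" using k l by (simp add: power_eq_if)
        then have "K ^ i * W = K * (K ^ (i - 1) * W)" by simp
        then show ?thesis by (simp only: K_def distrib_right mult_1)
      qed
      ultimately show ?thesis using x[of k] l by (simp add: add.commute)
    qed
  qed
  have "6 * real k * (\<delta> / (b - a)) * \<bar>E y0\<bar> * A \<le> \<bar>E y0\<bar> / 2"
  proof -
    have "6 * real k * (\<delta> / (b - a)) * A = 6 * real k * A / real N" using ab by (simp add: \<delta>_def)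
    also have "\<dots> \<le> 1 / 2" using N by (simp add: field_simps)
    finally have "(6 * real k * (\<delta> / (b - a)) * A) * \<bar>E y0\<bar> \<le> 1 / 2 * \<bar>E y0\<bar>"
      by (rule mult_right_mono) simp
    then show ?thesis by (simp add: mult_ac)
  qed
  then have step: "A * (2 * W + 6 * real k * (\<delta> / (b - a)) * \<bar>E y0\<bar>) \<le> 2 * A * W + \<bar>E y0\<bar> / 2"
    by (simp add: algebra_simps)
  define i where "i = nat \<lfloor>(y0 - a) / \<delta>\<rfloor>"
  have "0 \<le> (y0 - a) / \<delta>" using y0 \<delta> by simp
  then have i: "real i \<le> (y0 - a) / \<delta>" "(y0 - a) / \<delta> < real i + 1"
    unfolding i_def by linarith+
  then have i': "a + real i * \<delta> \<le> y0" "y0 < a + real i * \<delta> + \<delta>"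
    using \<delta> by (simp_all add: field_simps)
  have "real i * \<delta> \<le> real N * \<delta>" using i' y0 \<delta> by simp
  then have iN: "i \<le> N" using mult_le_cancel_right_pos[OF \<delta>(1)] by simp
  define u where "u = y0 - (a + real i * \<delta>)"
  have "\<bar>E y0 - E (a + real i * \<delta>)\<bar> \<le> 2 * A * W + \<bar>E y0\<bar> / 2"
  proof (cases "u = 0")
    case True
    then show ?thesis using A W by (simp add: u_def)
  next
    case False
    then have u: "0 < u" "u \<le> \<delta>" using i' by (auto simp: u_def)
    have "\<bar>fdiff 1 u E (a + real i * \<delta>)\<bar> \<le> A * (2 * W + 6 * real k * (\<delta> / (b - a)) * \<bar>E y0\<bar>)"
      unfolding A_def W_def
      by (rule fdiff_boundD[OF E.marchaud(1)[OF sup \<delta>(1) \<delta>_le] u])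
        (use in_grid[OF iN] y0 in \<open>auto simp: u_def\<close>)
    moreover have "fdiff 1 u E (a + real i * \<delta>) = E y0 - E (a + real i * \<delta>)" by (simp add: u_def)
    ultimately show ?thesis using step by linarith
  qed
  moreover have "\<bar>E (a + real i * \<delta>)\<bar> \<le> K ^ N * W"
    using grid[OF iN] iN K W by (meson mult_right_mono order_trans power_increasing)
  ultimately have "\<bar>E y0\<bar> \<le> K ^ N * W + 2 * A * W + \<bar>E y0\<bar> / 2" by linarith
  then have "\<bar>E y0\<bar> \<le> whitney_const k * w (b - a)"
    by (simp add: whitney_const_def K_def N_def A_def W_def algebra_simps)
  then have "\<bar>g y - poly P y\<bar> \<le> whitney_const k * w (b - a)" if "y \<in> {a..b}" for y
    using sup[OF that] by (simp add: E_def)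
  then show ?thesis using coeffs by blast
qed

end

section \<open>Symmetric differences and the modulus of smoothness\<close>

lemma fdiff_eq_sum:
  "fdiff k u g x = (\<Sum>i\<le>k. (- 1) ^ i * real (k choose i) * g (x + (real k - real i) * u))"
proof (induction k arbitrary: x)
  case (Suc k)
  define G where "G i = g (x + (real (Suc k) - real i) * u)" for i
  have 1: "fdiff k u g (x + u) = (\<Sum>i\<le>k. (- 1) ^ i * real (k choose i) * G i)"
    unfolding Suc.IH G_def by (simp add: algebra_simps)
  have 2: "fdiff k u g x = (\<Sum>i\<le>k. (- 1) ^ i * real (k choose i) * G (Suc i))"
    unfolding Suc.IH G_def by (simp add: algebra_simps)
  have "(\<Sum>i\<le>k. (- 1) ^ i * real (k choose i) * G i) = (\<Sum>i\<le>Suc k. (- 1) ^ i * real (k choose i) * G i)"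
    by simp
  also have "\<dots> = G 0 + (\<Sum>i\<le>k. (- 1) ^ Suc i * real (k choose Suc i) * G (Suc i))"
    by (subst sum.atMost_Suc_shift) simp
  finally have 3: "fdiff k u g (x + u) = G 0 + (\<Sum>i\<le>k. (- 1) ^ Suc i * real (k choose Suc i) * G (Suc i))"
    using 1 by simp
  have "(\<Sum>i\<le>Suc k. (- 1) ^ i * real (Suc k choose i) * G i)
     = G 0 + (\<Sum>i\<le>k. (- 1) ^ Suc i * real (Suc k choose Suc i) * G (Suc i))"
    by (subst sum.atMost_Suc_shift) simp
  also have "\<dots> = fdiff k u g (x + u) - fdiff k u g x"
    unfolding 2 3 add_diff_eq[symmetric] sum_subtractf[symmetric]
    by (intro arg_cong2[of _ _ _ _ "(+)"] refl sum.cong) (auto simp: algebra_simps)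
  finally show ?case by (simp add: G_def)
qed simp

lemma sym_diff_eq_fdiff:
  "sym_diff k u g x a b =
    (if a \<le> x - real k / 2 * u \<and> x + real k / 2 * u \<le> b then fdiff k u g (x - real k / 2 * u) else 0)"
proof -
  have eq: "x + (real k / 2 - real i) * u = x - real k / 2 * u + (real k - real i) * u" for i
    by (simp add: field_simps)
  then show ?thesis
    unfolding sym_diff_def fdiff_eq_sum eq by (simp only: atLeast0AtMost)
qed

text \<open>A real \<open>SUP\<close> is an upper bound only for bounded sets. The work therefore
  lies in bounding all differences uniformly, by \<open>2 ^ k\<close> times the maximum of the
  absolute value of \<open>g\<close> on the compact interval.\<close>

lemma smoothness_majorant_mod_smooth:
  assumes cont: "continuous_on {a..b} g" and ab: "a < b" and k: "0 < k"
  shows "smoothness_majorant k g a b (\<lambda>t. mod_smooth k g t a b)"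
proof -
  have "continuous_on {a..b} (\<lambda>y. \<bar>g y\<bar>)" by (intro continuous_intros cont)
  from continuous_attains_sup[OF compact_Icc _ this] ab
  obtain y0 where sup: "\<And>y. y \<in> {a..b} \<Longrightarrow> \<bar>g y\<bar> \<le> \<bar>g y0\<bar>" by force
  define B where "B = 2 ^ k * \<bar>g y0\<bar>"
  have B: "\<bar>sym_diff k u g x a b\<bar> \<le> B" if "0 < u" for u x
  proof (cases "a \<le> x - real k / 2 * u \<and> x + real k / 2 * u \<le> b")
    case True
    then have "x - real k / 2 * u + real k * u \<le> b" by (simp add: field_simps)
    then show ?thesis
      using fdiff_boundD[OF fdiff_bound_trivial[of a b g "\<bar>g y0\<bar>" k u, OF sup] that order_refl, of "x - real k / 2 * u"] True
      by (simp add: sym_diff_eq_fdiff B_def)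
  next
    case False
    then have "sym_diff k u g x a b = 0" unfolding sym_diff_eq_fdiff by (rule if_not_P)
    then show ?thesis by (simp add: B_def)
  qed
  define S where "S u = (SUP x. \<bar>sym_diff k u g x a b\<bar>)" for u
  have S_upper: "\<bar>sym_diff k u g x a b\<bar> \<le> S u" if "0 < u" for u x
    unfolding S_def using B[OF that] by (intro cSUP_upper bdd_aboveI2[of _ _ B]) auto
  have S_B: "S u \<le> B" if "0 < u" for u
    unfolding S_def using B[OF that] by (intro cSUP_least) auto
  have bdd: "bdd_above (S ` {0<..t})" for t
    using S_B by (intro bdd_aboveI2[of _ _ B]) auto
  have mod: "mod_smooth k g t a b = (SUP u\<in>{0<..t}. S u)" for t
    by (simp add: mod_smooth_def S_def)
  have upper: "\<bar>sym_diff k u g x a b\<bar> \<le> mod_smooth k g t a b" if "0 < u" "u \<le> t" for u t x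
    unfolding mod using that S_upper[of u x] cSUP_upper[OF _ bdd, of u t] by fastforce
  show ?thesis
  proof
    fix s t :: real assume st: "0 < s" "s \<le> t"
    then show "mod_smooth k g s a b \<le> mod_smooth k g t a b"
      unfolding mod by (intro cSUP_subset_mono bdd) auto
  next
    fix t :: real assume "0 < t"
    then show "0 \<le> mod_smooth k g t a b" using upper[of t t 0] by (smt (verit) abs_ge_zero)
  next
    fix t :: real assume "0 < t"
    show "fdiff_bound k g a b t (mod_smooth k g t a b)"
      unfolding fdiff_bound_def
    proof (intro allI impI)
      fix u x assume u: "0 < u" "u \<le> t" "a \<le> x" "x + real k * u \<le> b"
      then have "sym_diff k u g (x + real k / 2 * u) a b = fdiff k u g x"
        by (simp add: sym_diff_eq_fdiff field_simps)
      then show "\<bar>fdiff k u g x\<bar> \<le> mod_smooth k g t a b"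
        using upper[OF u(1,2), of "x + real k / 2 * u"] by simp
    qed
  qed (use k ab in auto)
qed

section \<open>From indexed nodes to multisets\<close>

definition nodes :: "(nat \<Rightarrow> real) \<Rightarrow> nat set \<Rightarrow> real multiset" where
  "nodes xs A = image_mset xs (mset_set A)"

lemma nodes_insert: "finite A \<Longrightarrow> i \<notin> A \<Longrightarrow> nodes xs (insert i A) = add_mset (xs i) (nodes xs A)"
  by (simp add: nodes_def)

lemma size_nodes: "size (nodes xs A) = card A"
  by (simp add: nodes_def)

lemma set_nodes: "finite A \<Longrightarrow> set_mset (nodes xs A) = xs ` A"
  by (simp add: nodes_def)

lemma count_nodes: "finite A \<Longrightarrow> count (nodes xs A) z = card {i \<in> A. xs i = z}"
proof -
  assume A: "finite A"
  have "xs -` {z} \<inter> A = {i \<in> A. xs i = z}" by auto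
  then show ?thesis using A by (simp add: nodes_def count_image_mset)
qed

text \<open>\<open>node_mult\<close> increases strictly along equal nodes and never exceeds their
  number, so by counting, the prescribed orders are exactly those below the multiplicity. This
  matches the indexed conditions with those of \<open>is_hermite\<close>.\<close>

lemma node_mult_image:
  "(\<lambda>j. node_mult xs j - 1) ` {j. j < m \<and> xs j = z} = {..<card {j \<in> {..<m}. xs j = z}}"
proof -
  define A where "A = {j \<in> {..<m}. xs j = z}"
  have A: "finite A" by (simp add: A_def)
  have fin: "finite {i. i \<le> j \<and> xs i = xs j}" for j by simp
  have pos: "0 < node_mult xs j" for j
    unfolding node_mult_def using fin[of j] by (auto simp: card_gt_0_iff)
  have le: "node_mult xs j \<le> card A" if "j \<in> A" for j
    unfolding node_mult_def using that A by (intro card_mono) (auto simp: A_def)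
  have less: "node_mult xs i < node_mult xs j" if "i \<in> A" "j \<in> A" "i < j" for i j
  proof -
    have "j \<in> {l. l \<le> j \<and> xs l = xs j} - {l. l \<le> i \<and> xs l = xs i}" using that by simp
    moreover have "{l. l \<le> i \<and> xs l = xs i} \<subseteq> {l. l \<le> j \<and> xs l = xs j}" using that by (auto simp: A_def)
    ultimately show ?thesis
      unfolding node_mult_def by (intro psubset_card_mono fin) blast
  qed
  have inj: "inj_on (\<lambda>j. node_mult xs j - 1) A"
  proof (rule inj_onI)
    fix i j assume ij: "i \<in> A" "j \<in> A" "node_mult xs i - 1 = node_mult xs j - 1"
    then have "node_mult xs i = node_mult xs j" using pos[of i] pos[of j] by linarith
    then show "i = j" using ij less[of i j] less[of j i] by (cases i j rule: linorder_cases) auto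
  qed
  have "(\<lambda>j. node_mult xs j - 1) ` A \<subseteq> {..<card A}"
  proof (rule image_subsetI)
    fix j assume "j \<in> A"
    then show "node_mult xs j - 1 \<in> {..<card A}"
      using le[of j] pos[of j] unfolding lessThan_iff by linarith
  qed
  then have "(\<lambda>j. node_mult xs j - 1) ` A = {..<card A}"
    using card_image[OF inj] by (intro card_subset_eq) auto
  then show ?thesis by (simp add: A_def)
qed

lemma hermite_interp_eq_hermite_poly:
  assumes "0 < m"
  shows "hermite_interp df xs m = hermite_poly df (nodes xs {..<m})"
proof -
  have "(degree p \<le> m - 1 \<and>
     (\<forall>j<m. poly ((pderiv ^^ (node_mult xs j - 1)) p) (xs j) = df (node_mult xs j - 1) (xs j)))
     \<longleftrightarrow> is_hermite df (nodes xs {..<m}) p" for p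
  proof -
    have "degree p \<le> m - 1 \<longleftrightarrow> (\<forall>i\<ge>m. coeff p i = 0)"
    proof
      assume "degree p \<le> m - 1"
      then show "\<forall>i\<ge>m. coeff p i = 0" using assms by (auto intro!: coeff_eq_0)
    next
      assume "\<forall>i\<ge>m. coeff p i = 0"
      then show "degree p \<le> m - 1" by (intro degree_le) auto
    qed
    moreover have "(\<forall>j<m. poly ((pderiv ^^ (node_mult xs j - 1)) p) (xs j) = df (node_mult xs j - 1) (xs j))
      \<longleftrightarrow> (\<forall>z. \<forall>i\<in>(\<lambda>j. node_mult xs j - 1) ` {j. j < m \<and> xs j = z}. poly ((pderiv ^^ i) p) z = df i z)"
      by auto
    ultimately show ?thesis
      unfolding is_hermite_def node_mult_image by (simp add: size_nodes count_nodes Ball_def)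
  qed
  then show ?thesis unfolding hermite_interp_def hermite_poly_def by simp
qed

lemma higher_antiderivative_poly:
  fixes P :: "real poly"
  assumes "\<And>i. k \<le> i \<Longrightarrow> coeff P i = 0"
  shows "\<exists>Q. (pderiv ^^ r) Q = P \<and> (\<forall>i\<ge>k + r. coeff Q i = 0)"
proof (induction r)
  case (Suc r)
  then obtain Q where Q: "(pderiv ^^ r) Q = P" "\<And>i. k + r \<le> i \<Longrightarrow> coeff Q i = 0" by blast
  define R where "R = (\<Sum>i<k + r. monom (coeff Q i / real (Suc i)) (Suc i))"
  have coeff_R: "coeff R n = (\<Sum>i<k + r. if Suc i = n then coeff Q i / real (Suc i) else 0)" for n
    unfolding R_def by (simp add: coeff_sum del: of_nat_Suc)
  have "pderiv R = Q"
  proof (rule poly_eqI)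
    fix n
    show "coeff (pderiv R) n = coeff Q n"
      using Q(2)[of n] by (auto simp: coeff_pderiv coeff_R)
  qed
  moreover have "coeff R i = 0" if "k + Suc r \<le> i" for i
    unfolding coeff_R using that by (intro sum.neutral) auto
  ultimately show ?case using Q(1) by (intro exI[of _ R]) (auto simp: funpow_Suc_right simp del: funpow.simps)
qed (use assms in auto)

section \<open>The interpolation error\<close>

locale separated_nodes =
  fixes m r :: nat and xs :: "nat \<Rightarrow> real" and a b lam :: real
  assumes rm: "r + 2 \<le> m" and ab: "a < b" and lam: "0 < lam" "lam \<le> 1"
    and sorted: "\<And>i j. i \<le> j \<Longrightarrow> j < m \<Longrightarrow> xs i \<le> xs j"
    and range: "\<And>i. i < m \<Longrightarrow> xs i \<in> {a..b}"
    and separated: "\<And>j. j + r + 2 \<le> m \<Longrightarrow> lam * (b - a) \<le> xs (j + r + 1) - xs j"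

text \<open>Derivatives are constrained only up to order \<open>r\<close>: by separation no node has
  multiplicity above \<open>r + 1\<close>, so interpolation asks for no higher order.\<close>

locale nodes_with_function = separated_nodes +
  fixes df :: "nat \<Rightarrow> real \<Rightarrow> real" and M :: real
  assumes der: "\<And>i t. i < r \<Longrightarrow> t \<in> {a..b} \<Longrightarrow> (df i has_real_derivative df (Suc i) t) (at t within {a..b})"
    and M: "\<And>t. t \<in> {a..b} \<Longrightarrow> \<bar>df r t\<bar> \<le> M"
begin

lemma M_nonneg: "0 \<le> M"
  using M[of a] ab by force

text \<open>For \<open>r + 1\<close> nodes this is the mean value form. Each further node costs one
  recursion that removes the smallest or the largest index; these indices differ by at least
  \<open>r + 1\<close>, so the divisor is at least \<open>lam * (b - a)\<close>, and the two terms
  in the numerator give the factor 2.\<close>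

lemma divdiff_nodes_bound:
  "A \<subseteq> {..<m} \<Longrightarrow> card A = r + 1 + n \<Longrightarrow> \<bar>divdiff df (nodes xs A)\<bar> \<le> (2 / (lam * (b - a))) ^ n * M"
proof (induction n arbitrary: A)
  case 0
  then have "finite A" by (meson finite_lessThan finite_subset)
  then have "\<exists>\<xi>\<in>{a..b}. divdiff df (nodes xs A) = df r \<xi> / fact r"
    using "0" range by (intro divdiff_mvt der) (auto simp: size_nodes set_nodes)
  then obtain \<xi> where \<xi>: "\<xi> \<in> {a..b}" "divdiff df (nodes xs A) = df r \<xi> / fact r" by blast
  have "\<bar>df r \<xi>\<bar> / fact r \<le> \<bar>df r \<xi>\<bar> / 1"
    by (intro divide_left_mono) auto
  then show ?case using \<xi> M[of \<xi>] by simp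
next
  case (Suc n)
  have fin: "finite A" using Suc.prems(1) by (meson finite_lessThan finite_subset)
  have ne: "A \<noteq> {}" using Suc.prems(2) by auto
  define i j where "i = Min A" and "j = Max A"
  have ij: "i \<in> A" "j \<in> A" using fin ne by (auto simp: i_def j_def)
  have "A \<subseteq> {i..j}" using fin by (auto simp: i_def j_def)
  then have "card A \<le> card {i..j}" by (rule card_mono[rotated]) simp
  then have gap: "i + r + 1 \<le> j" using Suc.prems(2) by simp
  have jm: "j < m" using ij Suc.prems(1) by auto
  define L where "L = lam * (b - a)"
  have L: "0 < L" using lam ab by (simp add: L_def)
  have "L \<le> xs (i + r + 1) - xs i" unfolding L_def using gap jm by (intro separated) auto
  also have "\<dots> \<le> xs j - xs i" using sorted[of "i + r + 1" j] gap jm by simp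
  finally have dist: "L \<le> xs j - xs i" .
  define N where "N = A - {i, j}"
  have N: "finite N" "i \<notin> N" "j \<notin> N" "i \<noteq> j" using fin gap by (auto simp: N_def)
  have A: "A = insert j (insert i N)" using ij by (auto simp: N_def)
  have "card A = card N + 2" unfolding A using N by simp
  then have card_N: "card N = r + n" using Suc.prems(2) by simp
  have "\<bar>divdiff df (nodes xs (insert l N))\<bar> \<le> (2 / L) ^ n * M" if "l \<in> {i, j}" for l
    unfolding L_def using that N card_N ij Suc.prems(1)
    by (intro Suc.IH) (auto simp: N_def)
  from this[of i] this[of j]
  have "\<bar>divdiff df (nodes xs (insert j N)) - divdiff df (nodes xs (insert i N))\<bar> \<le> 2 * ((2 / L) ^ n * M)"
    by simp
  moreover have "(xs j - xs i) * divdiff df (nodes xs A) =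
      divdiff df (nodes xs (insert j N)) - divdiff df (nodes xs (insert i N))"
    unfolding A using N by (simp add: nodes_insert divdiff_recursion)
  ultimately have "(xs j - xs i) * \<bar>divdiff df (nodes xs A)\<bar> \<le> 2 * ((2 / L) ^ n * M)"
    using dist L by (metis abs_mult abs_of_pos less_le_trans)
  moreover have "L * \<bar>divdiff df (nodes xs A)\<bar> \<le> (xs j - xs i) * \<bar>divdiff df (nodes xs A)\<bar>"
    using dist by (intro mult_right_mono) auto
  ultimately have "L * \<bar>divdiff df (nodes xs A)\<bar> \<le> 2 * ((2 / L) ^ n * M)" by linarith
  then have "\<bar>divdiff df (nodes xs A)\<bar> \<le> (2 / L) ^ Suc n * M"
    using L by (simp add: field_simps)
  then show ?case by (simp add: L_def)
qed

text \<open>With \<open>H j\<close> the value at \<open>x\<close> of the interpolant at the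
  \<open>j\<close> nearest nodes, the error splits at \<open>j = r + 1\<close>. The error of
  \<open>H (r + 1)\<close> gives the term with \<Phi>, the remaining Newton terms give the one with
  \<open>M\<close>.\<close>

lemma hermite_error:
  assumes bij: "bij_betw \<sigma> {..<m} {..<m}"
    and order: "\<And>\<nu>. 1 \<le> \<nu> \<Longrightarrow> \<nu> \<le> m - 1 \<Longrightarrow> \<bar>x - xs (\<sigma> (\<nu> - 1))\<bar> \<le> \<bar>x - xs (\<sigma> \<nu>)\<bar>"
    and x: "x \<in> {a..b}" "x \<notin> xs ` {..<m}"
    and d: "d = \<bar>x - xs (\<sigma> r)\<bar>"
    and osc: "\<And>y. y \<in> {a..b} \<Longrightarrow> \<bar>y - x\<bar> \<le> d \<Longrightarrow> \<bar>df r y - df r x\<bar> \<le> \<Phi>"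
  shows "\<bar>df 0 x - poly (hermite_poly df (nodes xs {..<m})) x\<bar>
    \<le> dist_prod r x xs \<sigma> * (2 * \<Phi> / d + real m * (2 / lam) ^ m * M / (b - a))"
proof -
  define h where "h = b - a"
  have h: "0 < h" using ab by (simp add: h_def)
  have \<sigma>_less: "\<sigma> i < m" if "i < m" for i using bij that by (auto simp: bij_betw_def)
  have inj: "inj_on \<sigma> {..<m}" using bij by (rule bij_betw_imp_inj_on)
  define S where "S j = \<sigma> ` {..<j}" for j
  have S: "finite (S j)" for j by (simp add: S_def)
  have S_sub: "S j \<subseteq> {..<m}" if "j \<le> m" for j using that \<sigma>_less by (auto simp: S_def)
  have S_card: "card (S j) = j" if "j \<le> m" for j
    unfolding S_def using inj that by (subst card_image) (auto intro: inj_on_subset)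
  have S_new: "\<sigma> j \<notin> S j" if "j < m" for j
    unfolding S_def using that inj_on_image_mem_iff[OF inj, of j "{..<j}"] by auto
  have S_Suc: "S (Suc j) = insert (\<sigma> j) (S j)" for j by (simp add: S_def lessThan_Suc)
  have S_m: "S m = {..<m}" using bij by (simp add: S_def bij_betw_def)
  define H where "H j = poly (hermite_poly df (nodes xs (S j))) x" for j
  define D where "D j = (\<Prod>i<j. \<bar>x - xs (\<sigma> i)\<bar>)" for j
  have D0: "0 \<le> D j" for j unfolding D_def by (intro prod_nonneg) simp
  have D_Suc: "dist_prod r x xs \<sigma> = D (Suc r)"
    by (simp add: dist_prod_def D_def atLeast0AtMost lessThan_Suc_atMost)
  have node_D: "\<bar>poly (node_poly (nodes xs (S j))) x\<bar> = D j" if "j \<le> m" for j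
    using that
  proof (induction j)
    case 0
    then show ?case by (simp add: S_def nodes_def D_def)
  next
    case (Suc j)
    have "\<bar>poly (node_poly (nodes xs (S (Suc j)))) x\<bar> = \<bar>(x - xs (\<sigma> j)) * poly (node_poly (nodes xs (S j))) x\<bar>"
      unfolding S_Suc using S_new[of j] Suc.prems by (simp add: nodes_insert S algebra_simps)
    also have "\<dots> = \<bar>x - xs (\<sigma> j)\<bar> * D j" using Suc by (simp add: abs_mult)
    finally show ?case by (simp add: D_def mult.commute)
  qed
  have newton: "H (Suc j) = H j + divdiff df (nodes xs (S (Suc j))) * poly (node_poly (nodes xs (S j))) x"
    if "j < m" for j
    unfolding H_def S_Suc nodes_insert[OF S S_new[OF that]] hermite_poly_newton by simp

  \<comment> \<open>Each factor of \<open>D\<close> beyond the first \<open>r + 1\<close> is at most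
    \<open>h\<close>. These powers cancel those in the bound for the divided difference except for
    one factor 1 / h.\<close>
  have chain: "\<bar>H (r + 1 + n) - H (r + 1)\<bar> \<le> real n * (D (Suc r) * ((2 / lam) ^ m * M / h))"
    if "r + 1 + n \<le> m" for n
    using that
  proof (induction n)
    case (Suc n)
    define c where "c = 2 / lam"
    have c: "1 \<le> c" using lam by (simp add: c_def)
    have D_le: "D (r + 1 + n) \<le> D (Suc r) * h ^ n"
      using Suc.prems
    proof (induction n)
      case (Suc n)
      have "xs (\<sigma> (r + 1 + n)) \<in> {a..b}" using Suc.prems by (intro range \<sigma>_less) simp
      then have "\<bar>x - xs (\<sigma> (r + 1 + n))\<bar> \<le> h" using x by (auto simp: h_def)
      then have "D (r + 1 + n) * \<bar>x - xs (\<sigma> (r + 1 + n))\<bar> \<le> (D (Suc r) * h ^ n) * h"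
        using Suc h D0 by (intro mult_mono) auto
      then show ?case by (simp add: D_def mult_ac)
    qed simp
    define l where "l = r + 1 + n"
    have l: "l < m" "card (S (Suc l)) = r + 1 + Suc n" using Suc.prems by (simp_all add: l_def S_card)
    have eq: "2 / (lam * (b - a)) = c / h" by (simp add: c_def h_def)
    have dd: "\<bar>divdiff df (nodes xs (S (Suc l)))\<bar> \<le> (c / h) ^ Suc n * M"
      using divdiff_nodes_bound[OF S_sub l(2)] l(1) unfolding eq by simp
    have "\<bar>H (Suc l) - H l\<bar> = \<bar>divdiff df (nodes xs (S (Suc l)))\<bar> * D l"
      using newton[of l] node_D[of l] l(1) by (simp add: abs_mult)
    also have "\<dots> \<le> (c / h) ^ Suc n * M * (D (Suc r) * h ^ n)"
      using dd D_le[folded l_def] D0[of l] order_trans[OF abs_ge_zero dd] by (intro mult_mono)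
    also have "\<dots> = c ^ Suc n * (D (Suc r) * (M / h))"
    proof -
      have "(c / h) ^ Suc n * h ^ n = c ^ Suc n / h" using h by (simp add: power_divide)
      then have "(c / h) ^ Suc n * h ^ n * (M * D (Suc r)) = c ^ Suc n / h * (M * D (Suc r))" by (rule arg_cong)
      then show ?thesis by (simp add: mult_ac)
    qed
    also have "\<dots> \<le> c ^ m * (D (Suc r) * (M / h))"
      using Suc.prems c D0 M_nonneg h by (intro mult_right_mono power_increasing) auto
    also have "\<dots> = D (Suc r) * (c ^ m * M / h)" by simp
    finally have new: "\<bar>H (Suc l) - H l\<bar> \<le> D (Suc r) * (c ^ m * M / h)" .
    have old: "\<bar>H l - H (r + 1)\<bar> \<le> real n * (D (Suc r) * (c ^ m * M / h))"
      unfolding c_def l_def using Suc by simp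
    have "\<bar>H (Suc l) - H (r + 1)\<bar> \<le> \<bar>H (Suc l) - H l\<bar> + \<bar>H l - H (r + 1)\<bar>" by simp
    also have "\<dots> \<le> D (Suc r) * (c ^ m * M / h) + real n * (D (Suc r) * (c ^ m * M / h))"
      by (intro add_mono new old)
    also have "\<dots> = real (Suc n) * (D (Suc r) * (c ^ m * M / h))"
      by (simp only: of_nat_Suc distrib_right mult_1_left)
    finally have "\<bar>H (Suc l) - H (r + 1)\<bar> \<le> real (Suc n) * (D (Suc r) * (c ^ m * M / h))" .
    then show ?case unfolding c_def l_def by simp
  qed simp

  have dist_le: "\<bar>x - xs (\<sigma> i)\<bar> \<le> d" if "i \<le> r" for i
  proof -
    have "\<bar>x - xs (\<sigma> i)\<bar> \<le> \<bar>x - xs (\<sigma> r)\<bar>"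
      using that
    proof (induction r rule: dec_induct)
      case (step j)
      then have "j < r" by simp
      then have "\<bar>x - xs (\<sigma> j)\<bar> \<le> \<bar>x - xs (\<sigma> (Suc j))\<bar>" using order[of "Suc j"] rm by simp
      then show ?case using step by linarith
    qed simp
    then show ?thesis by (simp add: d)
  qed
  have r: "\<sigma> r < m" using rm by (intro \<sigma>_less) simp
  have dpos: "0 < d" using x r by (auto simp: d)
  \<comment> \<open>The mean value form is applied on this smaller interval, which contains
    \<open>x\<close> and its \<open>r + 1\<close> nearest nodes, so that both mean value points fall
    under the oscillation bound \<Phi>.\<close>
  define lo hi where "lo = max a (x - d)" and "hi = min b (x + d)"
  have sub: "{lo..hi} \<subseteq> {a..b}" by (auto simp: lo_def hi_def)
  have mvt: "\<exists>\<xi>\<in>{lo..hi}. divdiff df Y = df r \<xi> / fact r"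
    if "size Y = Suc r" "set_mset Y \<subseteq> {lo..hi}" for Y
  proof (rule divdiff_mvt[OF _ that])
    fix i t assume "i < r" "t \<in> {lo..hi}"
    then show "(df i has_real_derivative df (Suc i) t) (at t within {lo..hi})"
      using der sub by (blast intro: DERIV_subset)
  qed
  define X where "X = nodes xs (S r)"
  have X: "size X = r" "set_mset X = xs ` S r"
    using rm S by (simp_all add: X_def size_nodes set_nodes S_card)
  have X_add: "nodes xs (S (Suc r)) = add_mset (xs (\<sigma> r)) X"
    unfolding X_def S_Suc using S_new[of r] rm S by (simp add: nodes_insert)
  have near: "xs (\<sigma> i) \<in> {lo..hi}" if "i \<le> r" for i
    using dist_le[OF that] range[OF \<sigma>_less, of i] that rm by (auto simp: lo_def hi_def)
  have x_near: "x \<in> {lo..hi}" using x dpos by (auto simp: lo_def hi_def)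
  have "set_mset X \<subseteq> {lo..hi}" unfolding X(2) S_def using near by auto
  then obtain \<xi> \<eta> where \<xi>: "\<xi> \<in> {lo..hi}" "divdiff df (add_mset x X) = df r \<xi> / fact r"
    and \<eta>: "\<eta> \<in> {lo..hi}" "divdiff df (add_mset (xs (\<sigma> r)) X) = df r \<eta> / fact r"
    using mvt[of "add_mset x X"] mvt[of "add_mset (xs (\<sigma> r)) X"] X(1) x_near near[of r] by auto
  have near_osc: "\<bar>df r y - df r x\<bar> \<le> \<Phi>" if "y \<in> {lo..hi}" for y
    using that by (intro osc) (auto simp: lo_def hi_def)
  \<comment> \<open>Dropping \<open>x\<close> or the node at distance \<open>d\<close> leaves
    \<open>r + 1\<close> points, just enough for the mean value form, and the divisor is exactly
    \<open>d\<close>.\<close>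
  define T where "T = divdiff df (add_mset x (add_mset (xs (\<sigma> r)) X))"
  have "(x - xs (\<sigma> r)) * T = (df r \<xi> - df r \<eta>) / fact r"
    unfolding T_def divdiff_recursion \<xi>(2) \<eta>(2) by (simp add: diff_divide_distrib)
  then have "d * \<bar>T\<bar> = \<bar>df r \<xi> - df r \<eta>\<bar> / fact r"
    unfolding d abs_mult[symmetric] by simp
  also have "\<dots> \<le> \<bar>df r \<xi> - df r \<eta>\<bar> / 1" by (intro divide_left_mono) auto
  also have "\<dots> \<le> 2 * \<Phi>" using near_osc[OF \<xi>(1)] near_osc[OF \<eta>(1)] by simp
  finally have T: "\<bar>T\<bar> \<le> 2 * \<Phi> / d" using dpos by (simp add: field_simps)
  \<comment> \<open>Interpolating also at \<open>x\<close> reproduces f(x), so the error of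
    \<open>H (Suc r)\<close> is a single Newton term.\<close>
  have "df 0 x = poly (hermite_poly df (add_mset x (nodes xs (S (Suc r))))) x"
    by (rule poly_hermite_poly_node[symmetric]) simp
  also have "\<dots> = H (Suc r) + T * poly (node_poly (nodes xs (S (Suc r)))) x"
    unfolding hermite_poly_newton H_def T_def X_add by simp
  finally have "\<bar>df 0 x - H (Suc r)\<bar> = \<bar>T\<bar> * D (Suc r)"
    using node_D[of "Suc r"] rm by (simp add: abs_mult)
  also have "\<dots> \<le> 2 * \<Phi> / d * D (Suc r)" using T D0 by (intro mult_right_mono)
  finally have near_part: "\<bar>df 0 x - H (Suc r)\<bar> \<le> D (Suc r) * (2 * \<Phi> / d)" by (simp add: mult.commute)
  define n where "n = m - (r + 1)"
  have n: "r + 1 + n = m" "n \<le> m" using rm by (auto simp: n_def)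
  have "\<bar>H m - H (Suc r)\<bar> \<le> real n * (D (Suc r) * ((2 / lam) ^ m * M / h))"
    using chain[of n] n by simp
  also have "\<dots> \<le> real m * (D (Suc r) * ((2 / lam) ^ m * M / h))"
    using n D0 M_nonneg h lam by (intro mult_right_mono) auto
  finally have "\<bar>df 0 x - H m\<bar> \<le> D (Suc r) * (2 * \<Phi> / d) + real m * (D (Suc r) * ((2 / lam) ^ m * M / h))"
    using near_part by linarith
  then show ?thesis
    unfolding D_Suc H_def S_m h_def by (simp add: algebra_simps)
qed

end

text \<open>Obtained from \<open>hermite_error\<close> by inserting Marchaud's bound for \<Phi> and
  M / h \<le> 4 \<open>whitney_const k\<close> J, with J the integral; 24 is 6 times 4.\<close>

definition hermite_const :: "nat \<Rightarrow> real \<Rightarrow> nat \<Rightarrow> real" where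
  "hermite_const m lam k = 2 * marchaud_const k * (4 + 24 * real k * whitney_const k)
     + 4 * real m * (2 / lam) ^ m * whitney_const k"

lemma whitney_const_nonneg: "0 < k \<Longrightarrow> 0 \<le> whitney_const k"
  using marchaud_const_ge_1[of k] by (simp add: whitney_const_def)

lemma hermite_const_nonneg: "0 < k \<Longrightarrow> 0 < lam \<Longrightarrow> 0 \<le> hermite_const m lam k"
  using marchaud_const_ge_1[of k] whitney_const_nonneg[of k] by (simp add: hermite_const_def)

text \<open>Interpolation reproduces polynomials of degree below m, so f may be replaced by f - Q, where
  the r-th derivative of Q is the Whitney approximant of the r-th derivative of f.\<close>
lemma (in separated_nodes) hermite_error_mod_smooth:
  assumes der: "\<And>i t. i < r \<Longrightarrow> t \<in> {a..b} \<Longrightarrow> (df i has_real_derivative df (Suc i) t) (at t within {a..b})"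
    and cont: "continuous_on {a..b} (df r)"
    and bij: "bij_betw \<sigma> {..<m} {..<m}"
    and order: "\<And>\<nu>. 1 \<le> \<nu> \<Longrightarrow> \<nu> \<le> m - 1 \<Longrightarrow> \<bar>x - xs (\<sigma> (\<nu> - 1))\<bar> \<le> \<bar>x - xs (\<sigma> \<nu>)\<bar>"
    and x: "x \<in> {a..b}" "x \<notin> xs ` {..<m}"
  shows "\<bar>df 0 x - poly (hermite_poly df (nodes xs {..<m})) x\<bar>
    \<le> hermite_const m lam (m - r) * dist_prod r x xs \<sigma> *
      integral {\<bar>x - xs (\<sigma> r)\<bar>..2 * (b - a)} (\<lambda>t. mod_smooth (m - r) (df r) t a b / t\<^sup>2)"
proof -
  define k where "k = m - r"
  have k: "0 < k" "k + r = m" using rm by (auto simp: k_def)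
  define w where "w = (\<lambda>t. mod_smooth k (df r) t a b)"
  interpret w: smoothness_majorant k "df r" a b w
    unfolding w_def by (rule smoothness_majorant_mod_smooth[OF cont ab k(1)])
  obtain P where P: "\<And>i. k \<le> i \<Longrightarrow> coeff P i = 0"
    "\<And>y. y \<in> {a..b} \<Longrightarrow> \<bar>df r y - poly P y\<bar> \<le> whitney_const k * w (b - a)"
    using w.whitney[OF cont] by blast
  obtain Q where Q: "(pderiv ^^ r) Q = P" "\<And>i. m \<le> i \<Longrightarrow> coeff Q i = 0"
    using higher_antiderivative_poly[of k P r] P(1) k(2) by auto
  define h where "h = b - a"
  have h: "0 < h" using ab by (simp add: h_def)
  define M where "M = whitney_const k * w h"
  define dg where "dg i t = df i t - poly ((pderiv ^^ i) Q) t" for i t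
  have dg_r: "dg r = (\<lambda>y. df r y - poly P y)" by (simp add: dg_def Q(1) fun_eq_iff)
  interpret E: smoothness_majorant k "dg r" a b w
    unfolding dg_r by (rule w.minus_poly) (rule P(1))
  interpret nodes_with_function m r xs a b lam dg M
  proof
    fix i t assume "i < r" "t \<in> {a..b}"
    then show "(dg i has_real_derivative dg (Suc i) t) (at t within {a..b})"
      unfolding dg_def by (auto intro!: derivative_eq_intros der poly_DERIV[THEN DERIV_subset])
  next
    fix t assume "t \<in> {a..b}"
    then show "\<bar>dg r t\<bar> \<le> M" using P(2) by (simp add: dg_r M_def h_def)
  qed
  define d where "d = \<bar>x - xs (\<sigma> r)\<bar>"
  have "\<sigma> r < m" using bij rm by (auto simp: bij_betw_def)
  then have d: "0 < d" "d \<le> h" using x range[of "\<sigma> r"] by (auto simp: d_def h_def)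
  define J where "J = w.tail d"
  define A where "A = marchaud_const k"
  have A: "1 \<le> A" unfolding A_def using k(1) by (rule marchaud_const_ge_1)
  define \<Phi> where "\<Phi> = A * (4 * d * J + 6 * real k * (d / h) * M)"
  have J: "0 \<le> J"
    unfolding J_def using d(1) w.w_nonneg by (intro integral_nonneg mono_div_square_integrable w.w_mono) auto
  \<comment> \<open>As d \<le> h, the block from h to 2h lies in the range of integration, so
    \<open>w h\<close>, and with it \<open>M\<close>, is controlled by h J.\<close>
  have "w h / (4 * h) \<le> integral {h..2 * h} (\<lambda>u. w u / u\<^sup>2)"
    using h w.w_mono w.w_nonneg by (intro mono_div_square_integral_ge)
  also have "\<dots> \<le> J"
    unfolding J_def h_def[symmetric]
    using d w.w_mono w.w_nonneg by (intro mono_div_square_integral_subset) auto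
  finally have "w h \<le> 4 * h * J" using h by (simp add: field_simps)
  then have "M \<le> whitney_const k * (4 * h * J)"
    unfolding M_def using whitney_const_nonneg[OF k(1)] by (rule mult_left_mono)
  then have M_J: "M / h \<le> 4 * whitney_const k * J" using h by (simp add: field_simps)
  have \<Phi>_nonneg: "0 \<le> \<Phi>" unfolding \<Phi>_def using A d h J M_nonneg by simp
  have bound: "fdiff_bound 1 (dg r) a b d \<Phi>"
    unfolding \<Phi>_def A_def J_def h_def using d M by (intro E.marchaud(2)) (auto simp: h_def)
  have osc: "\<bar>dg r y - dg r x\<bar> \<le> \<Phi>" if y: "y \<in> {a..b}" "\<bar>y - x\<bar> \<le> d" for y
  proof (cases x y rule: linorder_cases)
    case less
    then show ?thesis using fdiff_boundD[OF bound, of "y - x" x] y x(1) by simp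
  next
    case greater
    then show ?thesis using fdiff_boundD[OF bound, of "x - y" y] y x(1) by (simp add: abs_minus_commute)
  qed (use \<Phi>_nonneg in simp)
  have "is_hermite dg (nodes xs {..<m}) (hermite_poly df (nodes xs {..<m}) - Q)"
    using is_hermite_hermite_poly[of df "nodes xs {..<m}"] Q(2)
    by (simp add: is_hermite_def dg_def higher_pderiv_diff size_nodes)
  then have "hermite_poly dg (nodes xs {..<m}) = hermite_poly df (nodes xs {..<m}) - Q"
    by (rule hermite_poly_eqI)
  then have "\<bar>df 0 x - poly (hermite_poly df (nodes xs {..<m})) x\<bar>
      = \<bar>dg 0 x - poly (hermite_poly dg (nodes xs {..<m})) x\<bar>"
    by (simp add: dg_def)
  also have "\<dots> \<le> dist_prod r x xs \<sigma> * (2 * \<Phi> / d + real m * (2 / lam) ^ m * M / (b - a))"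
    using bij order x d_def osc by (rule hermite_error)
  also have "\<dots> \<le> dist_prod r x xs \<sigma> * (hermite_const m lam k * J)"
  proof (rule mult_left_mono)
    have "2 * \<Phi> / d = 2 * A * (4 * J + 6 * real k * (M / h))"
      using d by (simp add: \<Phi>_def field_simps)
    also have "\<dots> \<le> 2 * A * (4 * J + 6 * real k * (4 * whitney_const k * J))"
      using A M_J by (intro mult_left_mono add_left_mono) auto
    finally have 1: "2 * \<Phi> / d \<le> 2 * A * (4 * J + 6 * real k * (4 * whitney_const k * J))" .
    have "real m * (2 / lam) ^ m * (M / h) \<le> real m * (2 / lam) ^ m * (4 * whitney_const k * J)"
      using lam M_J by (intro mult_left_mono) auto
    with 1 show "2 * \<Phi> / d + real m * (2 / lam) ^ m * M / (b - a) \<le> hermite_const m lam k * J"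
      by (simp add: hermite_const_def A_def h_def algebra_simps)
    show "0 \<le> dist_prod r x xs \<sigma>" unfolding dist_prod_def by (intro prod_nonneg) simp
  qed
  finally show ?thesis
    by (simp add: J_def d_def w_def k_def mult_ac)
qed

theorem theorem5p3:
  fixes m :: nat and lam :: real
  assumes "0 < lam" and "lam \<le> 1"
  shows "\<exists>C. \<forall>(r::nat) (xs::nat \<Rightarrow> real) (f::real \<Rightarrow> real) (df::nat \<Rightarrow> real \<Rightarrow> real)
                (x::real) (\<sigma>::nat \<Rightarrow> nat).
     m \<ge> r + 2 \<longrightarrow>
     (\<forall>j. j + 1 < m \<longrightarrow> xs j \<le> xs (j + 1)) \<longrightarrow>
     xs 0 < xs (m - 1) \<longrightarrow>
     (\<forall>j. j + r + 2 \<le> m \<longrightarrow> xs (j + r + 1) - xs j \<ge> lam * (xs (m - 1) - xs 0)) \<longrightarrow>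
     (\<forall>t\<in>{xs 0..xs (m - 1)}. df 0 t = f t) \<longrightarrow>
     (\<forall>k<r. \<forall>t\<in>{xs 0..xs (m - 1)}.
         (df k has_real_derivative df (Suc k) t) (at t within {xs 0..xs (m - 1)})) \<longrightarrow>
     continuous_on {xs 0..xs (m - 1)} (df r) \<longrightarrow>
     x \<in> {xs 0..xs (m - 1)} \<longrightarrow>
     bij_betw \<sigma> {..<m} {..<m} \<longrightarrow>
     (\<forall>\<nu>. 1 \<le> \<nu> \<and> \<nu> \<le> m - 1 \<longrightarrow> \<bar>x - xs (\<sigma> (\<nu> - 1))\<bar> \<le> \<bar>x - xs (\<sigma> \<nu>)\<bar>) \<longrightarrow>
     \<bar>f x - poly (hermite_interp df xs m) x\<bar>
       \<le> C * dist_prod r x xs \<sigma> *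
          integral {\<bar>x - xs (\<sigma> r)\<bar>..2 * (xs (m - 1) - xs 0)}
            (\<lambda>t. mod_smooth (m - r) (df r) t (xs 0) (xs (m - 1)) / t ^ 2)"
proof (intro exI allI impI)
  fix r :: nat and xs :: "nat \<Rightarrow> real" and f :: "real \<Rightarrow> real" and df :: "nat \<Rightarrow> real \<Rightarrow> real"
    and x :: real and \<sigma> :: "nat \<Rightarrow> nat"
  define a b where "a = xs 0" and "b = xs (m - 1)"
  assume rm: "r + 2 \<le> m" and step: "\<forall>j. j + 1 < m \<longrightarrow> xs j \<le> xs (j + 1)" and ab: "xs 0 < xs (m - 1)"
    and sep: "\<forall>j. j + r + 2 \<le> m \<longrightarrow> lam * (xs (m - 1) - xs 0) \<le> xs (j + r + 1) - xs j"
    and f: "\<forall>t\<in>{xs 0..xs (m - 1)}. df 0 t = f t"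
    and der: "\<forall>k<r. \<forall>t\<in>{xs 0..xs (m - 1)}.
         (df k has_real_derivative df (Suc k) t) (at t within {xs 0..xs (m - 1)})"
    and cont: "continuous_on {xs 0..xs (m - 1)} (df r)"
    and x: "x \<in> {xs 0..xs (m - 1)}" and bij: "bij_betw \<sigma> {..<m} {..<m}"
    and order: "\<forall>\<nu>. 1 \<le> \<nu> \<and> \<nu> \<le> m - 1 \<longrightarrow> \<bar>x - xs (\<sigma> (\<nu> - 1))\<bar> \<le> \<bar>x - xs (\<sigma> \<nu>)\<bar>"
  note abs = a_def[symmetric] b_def[symmetric]
  have sorted: "i \<le> j \<Longrightarrow> j < m \<Longrightarrow> xs i \<le> xs j" for i j
  proof (induction j)
    case (Suc j)
    then show ?case using step[rule_format, of j] by (cases "i = Suc j") auto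
  qed simp
  have range: "xs i \<in> {a..b}" if "i < m" for i
    using sorted[of 0 i] sorted[of i "m - 1"] that by (simp add: a_def b_def)
  interpret separated_nodes m r xs a b lam
    using rm ab assms sorted range sep unfolding abs by unfold_locales auto
  define J where "J = integral {\<bar>x - xs (\<sigma> r)\<bar>..2 * (xs (m - 1) - xs 0)}
      (\<lambda>t. mod_smooth (m - r) (df r) t (xs 0) (xs (m - 1)) / t ^ 2)"
  have interp: "hermite_interp df xs m = hermite_poly df (nodes xs {..<m})"
    using rm by (intro hermite_interp_eq_hermite_poly) simp
  \<comment> \<open>The constant has to be fixed before \<open>r\<close>, hence before k = m - r.
    The sum over all possible \<open>k\<close> dominates each single constant, as these are
    nonnegative.\<close>
  show "\<bar>f x - poly (hermite_interp df xs m) x\<bar>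
     \<le> (\<Sum>k=1..m. hermite_const m lam k) * dist_prod r x xs \<sigma> * J"
  proof (cases "x \<in> xs ` {..<m}")
    \<comment> \<open>At a node both sides vanish, whatever the integral is: the interpolant is
      exact, and the nearest node, at distance 0, makes the product zero.\<close>
    case True
    then have "poly (hermite_interp df xs m) x = df 0 x"
      unfolding interp by (intro poly_hermite_poly_node) (simp add: set_nodes)
    moreover have "dist_prod r x xs \<sigma> = 0"
    proof -
      have "x \<in> xs ` \<sigma> ` {..<m}" using True bij by (simp add: bij_betw_def)
      then obtain i where i: "i < m" "x = xs (\<sigma> i)" by auto
      have "\<bar>x - xs (\<sigma> 0)\<bar> \<le> \<bar>x - xs (\<sigma> j)\<bar>" if "j < m" for j
        using that
      proof (induction j)
        case (Suc j)
        then have "1 \<le> Suc j \<and> Suc j \<le> m - 1" by linarith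
        then show ?case using Suc order[rule_format, of "Suc j"] by auto
      qed simp
      from this[OF i(1)] have "x = xs (\<sigma> 0)" using i(2) by simp
      then show ?thesis by (auto simp: dist_prod_def)
    qed
    ultimately show ?thesis using f x by simp
  next
    case False
    have "\<bar>df 0 x - poly (hermite_poly df (nodes xs {..<m})) x\<bar>
      \<le> hermite_const m lam (m - r) * dist_prod r x xs \<sigma> * J"
      unfolding J_def abs
      by (rule hermite_error_mod_smooth) (use der cont bij order x False abs in auto)
    moreover have "hermite_const m lam (m - r) * dist_prod r x xs \<sigma> * J
      \<le> (\<Sum>k=1..m. hermite_const m lam k) * dist_prod r x xs \<sigma> * J"
    proof (intro mult_right_mono member_le_sum)
      show "0 \<le> J"
      proof -
        interpret w: smoothness_majorant "m - r" "df r" a b "\<lambda>t. mod_smooth (m - r) (df r) t a b"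
          using cont ab rm unfolding abs by (intro smoothness_majorant_mod_smooth) auto
        have "\<sigma> r < m" using bij rm by (auto simp: bij_betw_def)
        then have "0 < \<bar>x - xs (\<sigma> r)\<bar>" using False by auto
        then show ?thesis
          unfolding J_def abs using w.w_nonneg
          by (intro integral_nonneg mono_div_square_integrable w.w_mono) auto
      qed
      show "0 \<le> dist_prod r x xs \<sigma>" unfolding dist_prod_def by (intro prod_nonneg) simp
    qed (use rm assms hermite_const_nonneg in auto)
    ultimately show ?thesis using f x interp by simp
  qed
qed

end
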